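(* Let $$\mathcal{C}_r:=\left(\int_{[0,\infty)^r}\frac{a(\mathbf{t})e^{-a(\mathbf{t})}}{1-e^{-a(\mathbf{t})}}\,dt_1\cdots dt_r\right)^{\frac{2}{r(r+3)}},\quad \mathcal{C}_{r,\mathrm{var}}:=\int_{[0,\infty)^r}\frac{a(\mathbf{t})^2e^{-a(\mathbf{t})}}{(1-e^{-a(\mathbf{t})})^2}\,dt_1\cdots dt_r,\quad \mathcal{D}_{r,\mathrm{var}}:=\frac{\mathcal{C}_{r,\mathrm{var}}}{\mathcal{C}_r^{r(r+2)}}.$$ Then the integrals involved converge, and as $n\to\infty$ the following hold: (1) $\displaystyle s_n=\mathcal{C}_r\,n^{-\frac{2}{r(r+3)}}\left(1+O\!\left(n^{-\frac{2}{r^2(r+3)}}\right)\right).$ (2) $\displaystyle \sigma_n^2=\mathcal{C}_{r,\mathrm{var}}\,s_n^{-r(r+2)}\left(1+O\!\left(s_n^{\frac1r}\right)\right)=\mathcal{D}_{r,\mathrm{var}}\,n^{\frac{2(r+2)}{r+3}}\left(1+O\!\left(n^{-\frac{2}{r^2(r+3)}}\right)\right).$ (3) $\displaystyle \sum_{\mathbf{k}\in\mathbb{N}^r}\frac{a(\mathbf{k})^3q_n^{a(\mathbf{k})}}{\left(1-q_n^{a(\mathbf{k})}\right)^3}=O\!\left(s_n^{-\frac{r(3r+5)}{2}}\right).$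
   Context: Throughout $r\ge 2$ is a fixed integer and $\mathbb{N}=\{1,2,\dots\}$. For $\mathbf{y}\in\mathbb{R}^r_{\ge0}$ put $$a(\mathbf{y}):=\frac{1}{c_r}\prod_{1\le\ell\le j\le r}(y_\ell+\dots+y_j),\qquad c_r:=r!\,(r-1)!\cdots1!.$$ For $n\in\mathbb{N}$, $q_n\in(0,1)$ is the unique solution $q$ of $\sum_{\mathbf{k}\in\mathbb{N}^r}\frac{a(\mathbf{k})q^{a(\mathbf{k})}}{1-q^{a(\mathbf{k})}}=n$; $s_n>0$ is defined by $q_n=\exp\big(-s_n^{r(r+1)/2}\big)$; and $$\sigma_n^2:=\sum_{\mathbf{k}\in\mathbb{N}^r}\frac{a(\mathbf{k})^2q_n^{a(\mathbf{k})}}{\left(1-q_n^{a(\mathbf{k})}\right)^2}.$$ (This is the variance of $\sum_{\mathbf{k}}a(\mathbf{k})X_{\mathbf{k}}$ when the $X_{\mathbf{k}}$, $\mathbf{k}\in\mathbb{N}^r$, are independent with $\mathrm{Prob}(X_{\mathbf{k}}=\ell)=q_n^{\ell a(\mathbf{k})}(1-q_n^{a(\mathbf{k})})$ for $\ell=0,1,2,\dots$.) Implied constants may depend on $r$. *)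

theory Defs
  imports "HOL-Analysis.Analysis" "HOL-Library.Landau_Symbols"
begin

text \<open>
  Vectors of length \<open>r\<close> are functions on the index set \<open>{1..r}\<close> (extensional ones when they range
  over a set), so that \<open>\<real>\<^sup>r\<close> with Lebesgue measure is the product measure \<open>\<Pi>\<^sub>M i\<in>{1..r}. lborel\<close>.
\<close>

definition c_const :: "nat \<Rightarrow> real" where
  "c_const r = (\<Prod>i=1..r. fact i)"

definition a_fun :: "nat \<Rightarrow> (nat \<Rightarrow> real) \<Rightarrow> real" where
  "a_fun r y = 1 / c_const r *
     (\<Prod>(l, j) \<in> {(l, j). 1 \<le> l \<and> l \<le> j \<and> j \<le> r}. \<Sum>i=l..j. y i)"

definition Npow :: "nat \<Rightarrow> (nat \<Rightarrow> nat) set" where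
  "Npow r = {1..r} \<rightarrow>\<^sub>E {1..}"

definition a_nat :: "nat \<Rightarrow> (nat \<Rightarrow> nat) \<Rightarrow> real" where
  "a_nat r k = a_fun r (\<lambda>i. real (k i))"

definition q_seq :: "nat \<Rightarrow> nat \<Rightarrow> real" where
  "q_seq r n = (THE q. 0 < q \<and> q < 1 \<and>
     ((\<lambda>k. a_nat r k * q powr a_nat r k / (1 - q powr a_nat r k)) has_sum real n) (Npow r))"

definition s_seq :: "nat \<Rightarrow> nat \<Rightarrow> real" where
  "s_seq r n = (THE s. 0 < s \<and> q_seq r n = exp (- (s powr (real r * (real r + 1) / 2))))"

definition sigma_sq_term :: "nat \<Rightarrow> nat \<Rightarrow> (nat \<Rightarrow> nat) \<Rightarrow> real" where
  "sigma_sq_term r n k =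
     (a_nat r k)\<^sup>2 * q_seq r n powr a_nat r k / (1 - q_seq r n powr a_nat r k)\<^sup>2"

definition sigma_sq :: "nat \<Rightarrow> nat \<Rightarrow> real" where
  "sigma_sq r n = (\<Sum>\<^sub>\<infinity>k\<in>Npow r. sigma_sq_term r n k)"

definition third_term :: "nat \<Rightarrow> nat \<Rightarrow> (nat \<Rightarrow> nat) \<Rightarrow> real" where
  "third_term r n k =
     (a_nat r k) ^ 3 * q_seq r n powr a_nat r k / (1 - q_seq r n powr a_nat r k) ^ 3"

definition lebesgue_pow :: "nat \<Rightarrow> (nat \<Rightarrow> real) measure" where
  "lebesgue_pow r = (\<Pi>\<^sub>M i\<in>{1..r}. lborel)"

definition orthant :: "nat \<Rightarrow> (nat \<Rightarrow> real) set" where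
  "orthant r = {1..r} \<rightarrow>\<^sub>E {0..}"

text \<open>
  On the null set where \<open>a_fun r t = 0\<close> the two integrands below are \<open>0\<close>, by \<open>x / 0 = 0\<close>.
\<close>

definition C_integrand :: "nat \<Rightarrow> (nat \<Rightarrow> real) \<Rightarrow> real" where
  "C_integrand r t = a_fun r t * exp (- a_fun r t) / (1 - exp (- a_fun r t))"

definition C_var_integrand :: "nat \<Rightarrow> (nat \<Rightarrow> real) \<Rightarrow> real" where
  "C_var_integrand r t = (a_fun r t)\<^sup>2 * exp (- a_fun r t) / (1 - exp (- a_fun r t))\<^sup>2"

definition C_const :: "nat \<Rightarrow> real" where
  "C_const r =
     (LINT t:orthant r|lebesgue_pow r. C_integrand r t) powr (2 / (real r * (real r + 3)))"

definition C_var :: "nat \<Rightarrow> real" where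
  "C_var r = (LINT t:orthant r|lebesgue_pow r. C_var_integrand r t)"

definition D_var :: "nat \<Rightarrow> real" where
  "D_var r = C_var r / C_const r ^ (r * (r + 2))"

end

theory Submission
  imports Defs
begin

text \<open>
  Let \<open>d = r (r + 1) / 2\<close> be the degree of the homogeneous polynomial \<open>a\<close> and write \<open>q = exp (- w)\<close>,
  \<open>w = s powr d\<close>. By homogeneity each of the three sums over \<open>k\<close> equals
  \<open>w powr - j * (\<Sum>k. g\<^sub>j (a (s k)))\<close> with \<open>g\<^sub>j x = x ^ j * exp (- x) / (1 - exp (- x)) ^ j\<close> and
  \<open>j = 1, 2, 3\<close>. Up to the factor \<open>s ^ r\<close> this is a Riemann sum of mesh \<open>s\<close> for the integral of
  \<open>g\<^sub>j \<circ> a\<close> over the orthant.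

  For \<open>j = 1, 2\<close> the function \<open>g\<^sub>j\<close> decreases, and \<open>a\<close> increases in every coordinate. Comparison
  over cubes therefore gives, with no smoothness argument,
  \<open>integral - mass of the slabs {t. t i < s} \<le> s ^ r * sum \<le> integral\<close>
  (lemmas \<open>lattice_sum_le_nn_integral\<close> and \<open>nn_integral_le_lattice_sum\<close>). As \<open>g\<^sub>j x \<le> 24 / (1 + x)\<close>
  for all three \<open>j\<close>, everything comes down to two facts about \<open>1 / (1 + a t)\<close>: it is integrable over
  the orthant, and its mass over a slab of width \<open>s\<close> is \<open>O(s powr (1 / r))\<close>. The latter is the
  source of the error terms.

  Both facts follow from monomial lower bounds for \<open>a\<close>. Each factor satisfies
  \<open>t l + \<dots> + t j \<ge> max (t l) (t j)\<close>. For any index \<open>m\<close>, estimating the factors with an end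
  at \<open>m\<close> by \<open>t m\<close> and all others by the geometric mean of \<open>t l\<close> and \<open>t j\<close> yields
  \<open>c\<^sub>r a t \<ge> t m powr r * (\<Prod>j\<noteq>m. t j powr (r / 2))\<close>. Used where \<open>t m\<close> is the largest coordinate,
  this makes \<open>1 / (1 + a t)\<close> integrable (lemma \<open>nn_integral_decay_finite\<close>). On the slice \<open>t i = u\<close>
  the factors with an end at \<open>i\<close> are estimated by the other end instead, which gives
  \<open>c\<^sub>r a t \<ge> u * t m powr r * (\<Prod>j\<noteq>i,m. t j powr ((r + 1) / 2))\<close>. This monomial has degree
  \<open>D = (r - 1) (r + 2) / 2\<close> in the \<open>r - 1\<close> remaining coordinates, so rescaling those by
  \<open>u powr (- 1 / D)\<close> absorbs \<open>u\<close> and bounds the slice by a constant times \<open>u powr (- 2 / (r + 2))\<close>. Integrating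
  over \<open>0 < u < s\<close> gives \<open>O(s powr (r / (r + 2)))\<close>, and \<open>r / (r + 2) \<ge> 1 / r\<close> for \<open>r \<ge> 2\<close>, with
  equality for \<open>r = 2\<close>.

  Finally, the equation that defines \<open>q\<^sub>n\<close> reads
  \<open>s powr (r (r + 3) / 2) * n = s ^ r * sum = integral * (1 + O(s powr (1 / r)))\<close>. Solving for \<open>s\<close>
  gives the first expansion, and inserting it into the Riemann sum for \<open>j = 2\<close> gives the second. For
  \<open>j = 3\<close> only an upper bound is claimed, and the Riemann sum of the majorant \<open>24 / (1 + x)\<close> provides it.
\<close>

section \<open>Monomial lower bounds for the product\<close>

text \<open>
  The index set of the factors of \<open>a\<close>, for an arbitrary set \<open>J\<close> of coordinates instead of
  \<open>{1..r}\<close>, so that single coordinates can be split off.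
\<close>

definition ordered_pairs :: "nat set \<Rightarrow> (nat \<times> nat) set" where
  "ordered_pairs J = {(l, j). l \<in> J \<and> j \<in> J \<and> l \<le> j}"

lemma finite_ordered_pairs [simp]: "finite J \<Longrightarrow> finite (ordered_pairs J)"
  by (rule finite_subset[of _ "J \<times> J"]) (auto simp: ordered_pairs_def)

lemma prod_ordered_pairs_insert:
  fixes f :: "nat \<times> nat \<Rightarrow> 'a::comm_monoid_mult"
  assumes "finite J" "i \<notin> J"
  shows "prod f (ordered_pairs (insert i J)) =
    f (i, i) * (\<Prod>j\<in>J. f (min i j, max i j)) * prod f (ordered_pairs J)"
proof -
  let ?g = "\<lambda>j. (min i j, max i j)"
  have eq: "ordered_pairs (insert i J) = insert (i, i) (?g ` J) \<union> ordered_pairs J"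
  proof (intro equalityI subsetI)
    fix p assume p: "p \<in> ordered_pairs (insert i J)"
    then obtain l j where p_def: "p = (l, j)" and lj: "l \<in> insert i J" "j \<in> insert i J" "l \<le> j"
      by (auto simp: ordered_pairs_def)
    show "p \<in> insert (i, i) (?g ` J) \<union> ordered_pairs J"
    proof (cases "l \<in> J \<and> j \<in> J")
      case True
      then show ?thesis using lj by (simp add: p_def ordered_pairs_def)
    next
      case False
      then have "p = (i, i) \<or> (j \<in> J \<and> p = ?g j) \<or> (l \<in> J \<and> p = ?g l)"
        using lj by (auto simp: p_def)
      then show ?thesis by blast
    qed
  next
    fix p assume "p \<in> insert (i, i) (?g ` J) \<union> ordered_pairs J"
    then show "p \<in> ordered_pairs (insert i J)"
      by (auto simp: ordered_pairs_def min_def max_def split: if_splits)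
  qed
  have inj: "inj_on ?g J"
    by (auto simp: inj_on_def min_def max_def split: if_splits)
  have disj: "insert (i, i) (?g ` J) \<inter> ordered_pairs J = {}"
    using assms by (auto simp: ordered_pairs_def min_def max_def split: if_splits)
  have ni: "(i, i) \<notin> ?g ` J"
    using assms by (auto simp: min_def max_def split: if_splits)
  have "prod f (ordered_pairs (insert i J)) = prod f (insert (i, i) (?g ` J)) * prod f (ordered_pairs J)"
    unfolding eq using assms disj by (intro prod.union_disjoint) auto
  also have "prod f (insert (i, i) (?g ` J)) = f (i, i) * (\<Prod>j\<in>J. f (?g j))"
    using ni assms inj by (simp add: prod.reindex)
  finally show ?thesis .
qed

text \<open>
  The factor of a pair \<open>l < j\<close> is at least the geometric mean of \<open>t l\<close> and \<open>t j\<close>, and a coordinate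
  occurs in one diagonal pair and in \<open>card J - 1\<close> other pairs; this adds up to the exponent
  \<open>1 + (card J - 1) / 2\<close>.
\<close>

lemma prod_ordered_pairs_ge:
  fixes f :: "nat \<times> nat \<Rightarrow> real"
  assumes "finite J" and "\<And>j. j \<in> J \<Longrightarrow> 0 < t j"
    and "\<And>l j. (l, j) \<in> ordered_pairs J \<Longrightarrow> t l \<le> f (l, j) \<and> t j \<le> f (l, j)"
  shows "(\<Prod>j\<in>J. t j powr ((real (card J) + 1) / 2)) \<le> prod f (ordered_pairs J)"
  using assms
proof (induction J rule: finite_induct)
  case empty
  then show ?case by (simp add: ordered_pairs_def)
next
  case (insert i J)
  let ?n = "real (card J)"
  have IH: "(\<Prod>j\<in>J. t j powr ((?n + 1) / 2)) \<le> prod f (ordered_pairs J)"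
    using insert.prems by (intro insert.IH) (auto simp: ordered_pairs_def)
  have pos: "0 < t j" if "j \<in> insert i J" for j using insert.prems that by auto
  have mixed: "t i powr (1/2) * t j powr (1/2) \<le> f (min i j, max i j)" if "j \<in> J" for j
  proof -
    have P: "(min i j, max i j) \<in> ordered_pairs (insert i J)"
      using that by (auto simp: ordered_pairs_def min_def max_def)
    have "t i powr (1/2) * t j powr (1/2) \<le>
      f (min i j, max i j) powr (1/2) * f (min i j, max i j) powr (1/2)"
      using insert.prems(2)[OF P] pos[of i] pos[of j] that
      by (intro mult_mono powr_mono2) (auto simp: min_def max_def split: if_splits)
    also have "\<dots> = f (min i j, max i j)"
    proof -
      have "0 < f (min i j, max i j)"
        using insert.prems(2)[OF P] pos[of i] pos[of j] that
        by (auto simp: min_def max_def split: if_splits)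
      then show ?thesis by (simp add: powr_add[symmetric])
    qed
    finally show ?thesis .
  qed
  have diag: "t i \<le> f (i, i)"
    using insert.prems(2)[of i i] by (auto simp: ordered_pairs_def)
  have "(\<Prod>j\<in>insert i J. t j powr ((real (card (insert i J)) + 1) / 2)) =
     t i powr ((?n + 2) / 2) * (\<Prod>j\<in>J. t j powr (1/2) * t j powr ((?n + 1) / 2))"
    using insert.hyps by (simp add: powr_add[symmetric] add_divide_distrib add.commute)
  also have "t i powr ((?n + 2) / 2) = t i * (\<Prod>j\<in>J. t i powr (1/2))"
    using pos[of i] by (simp add: powr_power add_divide_distrib powr_add)
  also have "t i * (\<Prod>j\<in>J. t i powr (1/2)) * (\<Prod>j\<in>J. t j powr (1/2) * t j powr ((?n + 1) / 2)) =
     t i * (\<Prod>j\<in>J. t i powr (1/2) * t j powr (1/2)) * (\<Prod>j\<in>J. t j powr ((?n + 1) / 2))"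
    by (simp add: prod.distrib)
  also have "\<dots> \<le> f (i, i) * (\<Prod>j\<in>J. f (min i j, max i j)) * prod f (ordered_pairs J)"
    using diag mixed IH pos[of i] insert.hyps
    by (intro mult_mono prod_mono mult_nonneg_nonneg prod_nonneg) (auto intro: order_trans[OF _ mixed])
  finally show ?case
    using insert.hyps by (simp add: prod_ordered_pairs_insert)
qed

text \<open>
  The \<open>card J\<close> pairs that contain \<open>m\<close> contribute \<open>t m\<close> each; the geometric means are used only for
  the pairs that avoid \<open>m\<close>. Compared with \<open>prod_ordered_pairs_ge\<close>, weight is shifted to the
  coordinate \<open>m\<close>, which is what makes the bound strong enough for integrability when \<open>t m\<close> is the
  largest coordinate.
\<close>

lemma prod_ordered_pairs_ge_distinguished:
  fixes f :: "nat \<times> nat \<Rightarrow> real"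
  assumes "finite J" "m \<in> J" and pos: "\<And>j. j \<in> J \<Longrightarrow> 0 < t j"
    and ge: "\<And>l j. (l, j) \<in> ordered_pairs J \<Longrightarrow> t l \<le> f (l, j) \<and> t j \<le> f (l, j)"
  shows "t m powr real (card J) * (\<Prod>j\<in>J - {m}. t j powr (real (card J) / 2))
    \<le> prod f (ordered_pairs J)"
proof -
  let ?J = "J - {m}"
  have card: "card J = Suc (card ?J)"
    using assms by (simp only: card_Suc_Diff1)
  have row: "t m \<le> f (min m j, max m j)" if "j \<in> J" for j
    using ge[of "min m j" "max m j"] that assms(2)
    by (auto simp: ordered_pairs_def min_def max_def split: if_splits)
  have "(\<Prod>j\<in>?J. t j powr ((real (card ?J) + 1) / 2)) \<le> prod f (ordered_pairs ?J)"
    using assms by (intro prod_ordered_pairs_ge) (auto simp: ordered_pairs_def)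
  then have rest: "(\<Prod>j\<in>?J. t j powr (real (card J) / 2)) \<le> prod f (ordered_pairs ?J)"
    by (simp add: card add.commute)
  have "t m powr real (card J) = t m * (\<Prod>j\<in>?J. t m)"
    using pos[OF assms(2)] by (simp add: card powr_add powr_realpow)
  also have "t m * (\<Prod>j\<in>?J. t m) * (\<Prod>j\<in>?J. t j powr (real (card J) / 2))
     \<le> f (m, m) * (\<Prod>j\<in>?J. f (min m j, max m j)) * prod f (ordered_pairs ?J)"
    using row[OF assms(2)] row rest pos[OF assms(2)]
    by (intro mult_mono prod_mono mult_nonneg_nonneg prod_nonneg) (auto intro: order_trans[OF _ row])
  also have "\<dots> = prod f (ordered_pairs J)"
    using prod_ordered_pairs_insert[of ?J m f] assms by (simp add: insert_absorb)
  finally show ?thesis .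
qed

lemma c_const_pos: "0 < c_const r"
  by (auto simp: c_const_def intro!: prod_pos)

lemma a_fun_ordered_pairs:
  "a_fun r y = prod (\<lambda>(l, j). \<Sum>i=l..j. y i) (ordered_pairs {1..r}) / c_const r"
proof -
  have "{(l, j). 1 \<le> l \<and> l \<le> j \<and> j \<le> r} = ordered_pairs {1..r}"
    by (auto simp: ordered_pairs_def)
  then show ?thesis by (simp add: a_fun_def)
qed

lemma prod_const_ordered_pairs:
  fixes s :: real
  assumes "finite J" "0 < s"
  shows "(\<Prod>p\<in>ordered_pairs J. s) = s powr (real (card J) * (real (card J) + 1) / 2)"
  using assms(1)
proof (induction J rule: finite_induct)
  case empty
  then show ?case using assms by (simp add: ordered_pairs_def)
next
  case (insert i J)
  let ?n = "real (card J)"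
  have "(\<Prod>p\<in>ordered_pairs (insert i J). s) =
      s powr 1 * s powr ?n * s powr (?n * (?n + 1) / 2)"
    using insert assms prod_ordered_pairs_insert[of J i "\<lambda>_. s"] by (simp add: powr_realpow)
  also have "\<dots> = s powr (1 + ?n + ?n * (?n + 1) / 2)"
    by (simp add: powr_add)
  also have "1 + ?n + ?n * (?n + 1) / 2 = real (card (insert i J)) * (real (card (insert i J)) + 1) / 2"
    using insert by (simp add: field_simps)
  finally show ?case .
qed

lemma a_fun_cong:
  assumes "\<And>i. i \<in> {1..r} \<Longrightarrow> t i = t' i"
  shows "a_fun r t = a_fun r t'"
  unfolding a_fun_ordered_pairs using assms
  by (intro arg_cong2[where f = "(/)"] prod.cong) (auto simp: ordered_pairs_def intro!: sum.cong)

lemma a_fun_mono: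
  assumes "\<And>i. i \<in> {1..r} \<Longrightarrow> 0 \<le> t i" "\<And>i. i \<in> {1..r} \<Longrightarrow> t i \<le> t' i"
  shows "a_fun r t \<le> a_fun r t'"
  unfolding a_fun_ordered_pairs using assms c_const_pos[of r]
  by (intro divide_right_mono prod_mono)
    (auto simp: ordered_pairs_def intro!: sum_mono sum_nonneg)

text \<open>
  Homogeneity, which turns the sums over \<open>k\<close> into sums over the lattice of mesh \<open>s\<close>.
\<close>

lemma a_fun_scale:
  assumes "0 < s"
  shows "a_fun r (\<lambda>i. s * t i) = s powr (real r * (real r + 1) / 2) * a_fun r t"
proof -
  have "prod (\<lambda>(l, j). \<Sum>i=l..j. s * t i) (ordered_pairs {1..r}) =
      (\<Prod>p\<in>ordered_pairs {1..r}. s * (case p of (l, j) \<Rightarrow> \<Sum>i=l..j. t i))"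
    by (intro prod.cong) (auto simp: sum_distrib_left)
  also have "\<dots> = (\<Prod>p\<in>ordered_pairs {1..r}. s) * prod (\<lambda>(l, j). \<Sum>i=l..j. t i) (ordered_pairs {1..r})"
    by (rule prod.distrib)
  finally have "prod (\<lambda>(l, j). \<Sum>i=l..j. s * t i) (ordered_pairs {1..r}) =
      (\<Prod>p\<in>ordered_pairs {1..r}. s) * prod (\<lambda>(l, j). \<Sum>i=l..j. t i) (ordered_pairs {1..r})" .
  then show ?thesis
    using prod_const_ordered_pairs[of "{1..r}" s] assms by (simp add: a_fun_ordered_pairs)
qed

lemma a_fun_measurable [measurable]: "a_fun r \<in> borel_measurable (\<Pi>\<^sub>M i\<in>{1..r}. lborel)"
  unfolding a_fun_ordered_pairs[abs_def]
proof (intro borel_measurable_divide borel_measurable_const borel_measurable_prod)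
  fix p assume p: "p \<in> ordered_pairs {1..r}"
  then have sub: "{fst p..snd p} \<subseteq> {1..r}" by (auto simp: ordered_pairs_def)
  have "(\<lambda>y. y i) \<in> borel_measurable (\<Pi>\<^sub>M i\<in>{1..r}. lborel :: real measure)" if "i \<in> {fst p..snd p}" for i
    using measurable_component_singleton[of i "{1..r}" "\<lambda>_. lborel :: real measure"] sub that by auto
  then show "(\<lambda>y :: nat \<Rightarrow> real. case p of (l, j) \<Rightarrow> \<Sum>i=l..j. y i) \<in> borel_measurable (\<Pi>\<^sub>M i\<in>{1..r}. lborel)"
    unfolding case_prod_beta by (intro borel_measurable_sum)
qed

lemma a_fun_pos:
  assumes "\<And>i. i \<in> {1..r} \<Longrightarrow> 0 < t i"
  shows "0 < a_fun r t"
  unfolding a_fun_ordered_pairs using assms c_const_pos[of r]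
  by (auto simp: ordered_pairs_def intro!: divide_pos_pos prod_pos sum_pos)

lemma a_nat_pos: "k \<in> Npow r \<Longrightarrow> 0 < a_nat r k"
  unfolding a_nat_def by (rule a_fun_pos) (force simp: Npow_def PiE_def Pi_def)

lemma block_sum_ge:
  fixes t :: "nat \<Rightarrow> real"
  assumes "\<And>i. i \<in> {1..r} \<Longrightarrow> 0 \<le> t i" "(l, j) \<in> ordered_pairs {1..r}"
  shows "t l \<le> (\<Sum>i=l..j. t i) \<and> t j \<le> (\<Sum>i=l..j. t i)"
  using assms by (auto simp: ordered_pairs_def intro!: member_le_sum)

lemma a_fun_ge_distinguished:
  assumes "m \<in> {1..r}" "\<And>i. i \<in> {1..r} \<Longrightarrow> 0 < t i"
  shows "t m powr real r * (\<Prod>j\<in>{1..r} - {m}. t j powr (real r / 2)) / c_const r \<le> a_fun r t"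
  unfolding a_fun_ordered_pairs
  using assms block_sum_ge[of r t] c_const_pos[of r]
    prod_ordered_pairs_ge_distinguished[of "{1..r}" m t "\<lambda>(l, j). \<Sum>i=l..j. t i"]
  by (intro divide_right_mono) (auto simp: less_imp_le)

text \<open>
  The factors whose block ends at \<open>i\<close> are bounded by the coordinate at the other end, and the
  remaining ones form the same product on \<open>{1..r} - {i}\<close>. In this way \<open>t i\<close> enters to the first
  power only, however small it is.
\<close>

lemma a_fun_ge_slice:
  assumes "i \<in> {1..r}" "m \<in> {1..r} - {i}" and pos: "\<And>i. i \<in> {1..r} \<Longrightarrow> 0 < t i"
  shows "t i * (t m powr real r * (\<Prod>j\<in>{1..r} - {i} - {m}. t j powr ((real r + 1) / 2))) / c_const r
    \<le> a_fun r t"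
proof -
  let ?J = "{1..r} - {i}"
  let ?f = "\<lambda>(l, j). \<Sum>i=l..j. t i"
  have card: "real (card ?J) = real r - 1" using assms by auto
  have ge: "t l \<le> ?f (l, j) \<and> t j \<le> ?f (l, j)" if "(l, j) \<in> ordered_pairs {1..r}" for l j
    using block_sum_ge[of r t l j] that pos by (auto simp: less_imp_le)
  have J: "t m powr (real r - 1) * (\<Prod>j\<in>?J - {m}. t j powr ((real r - 1) / 2))
    \<le> prod ?f (ordered_pairs ?J)"
    using prod_ordered_pairs_ge_distinguished[of ?J m t ?f] assms ge
    unfolding card by (auto simp: ordered_pairs_def)
  have row: "t j \<le> ?f (min i j, max i j)" if "j \<in> {1..r}" for j
    using ge[of "min i j" "max i j"] that assms(1)
    by (auto simp: ordered_pairs_def min_def max_def split: if_splits)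
  have row_nonneg: "0 \<le> ?f (min i j, max i j)" if "j \<in> {1..r}" for j
    using row[OF that] pos[OF that] by linarith
  have posm: "0 < t m" using pos assms by auto
  have split: "(\<Prod>j\<in>?J. t j) = t m * (\<Prod>j\<in>?J - {m}. t j)"
    using assms by (intro prod.remove) auto
  have "t i * (t m powr real r * (\<Prod>j\<in>?J - {m}. t j powr ((real r + 1) / 2))) =
     t i * (t m powr (1 + (real r - 1)) * (\<Prod>j\<in>?J - {m}. t j powr (1 + (real r - 1) / 2)))"
    by (simp add: field_simps)
  also have "\<dots> = t i * (\<Prod>j\<in>?J. t j) *
     (t m powr (real r - 1) * (\<Prod>j\<in>?J - {m}. t j powr ((real r - 1) / 2)))"
  proof -
    have "(\<Prod>j\<in>?J - {m}. t j powr (1 + (real r - 1) / 2)) =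
        (\<Prod>j\<in>?J - {m}. t j) * (\<Prod>j\<in>?J - {m}. t j powr ((real r - 1) / 2))"
      using pos by (simp only: powr_add prod.distrib, intro arg_cong2[where f = "(*)"] prod.cong)
        (auto simp: less_imp_le)
    then show ?thesis
      unfolding split powr_add using posm by simp
  qed
  also have "\<dots> \<le> ?f (i, i) * (\<Prod>j\<in>?J. ?f (min i j, max i j)) * prod ?f (ordered_pairs ?J)"
    using row row_nonneg row_nonneg[OF assms(1)] row[OF assms(1)] J pos assms(1)
    by (intro mult_mono prod_mono mult_nonneg_nonneg prod_nonneg) (auto intro: less_imp_le)
  also have "\<dots> = prod ?f (ordered_pairs {1..r})"
    using prod_ordered_pairs_insert[of ?J i ?f] assms by (simp add: insert_absorb)
  finally show ?thesis
    unfolding a_fun_ordered_pairs using c_const_pos[of r] by (intro divide_right_mono) auto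
qed

section \<open>Decay of reciprocals of monomials on the orthant\<close>

text \<open>
  Integrable over the real line exactly when \<open>\<beta> < 1 < \<gamma>\<close>. Products of such functions serve as
  majorants because they integrate coordinate by coordinate.
\<close>

definition two_powers :: "real \<Rightarrow> real \<Rightarrow> real \<Rightarrow> real" where
  "two_powers \<beta> \<gamma> x = (if x \<le> 0 then 0 else if x \<le> 1 then x powr (- \<beta>) else x powr (- \<gamma>))"

lemma two_powers_nonneg [simp]: "0 \<le> two_powers \<beta> \<gamma> x"
  by (simp add: two_powers_def)

lemma two_powers_ge_1: "0 < x \<Longrightarrow> x \<le> 1 \<Longrightarrow> 0 \<le> \<beta> \<Longrightarrow> 1 \<le> two_powers \<beta> \<gamma> x"
  using powr_mono'[of "- \<beta>" 0 x] by (simp add: two_powers_def)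

lemma two_powers_measurable [measurable]: "two_powers \<beta> \<gamma> \<in> borel_measurable borel"
  unfolding two_powers_def by measurable

lemma nn_integral_two_powers:
  assumes "\<beta> < 1" "1 < \<gamma>"
  shows "(\<integral>\<^sup>+x. ennreal (two_powers \<beta> \<gamma> x) \<partial>lborel) < \<infinity>"
proof -
  have "(\<integral>\<^sup>+x. ennreal (x powr (- \<beta>)) * indicator {0..1} x \<partial>lborel) = ennreal (1 powr (- \<beta> + 1) / (- \<beta> + 1))"
    using assms by (intro nn_integral_has_integral_lebesgue' has_integral_powr_from_0) auto
  moreover have "(\<integral>\<^sup>+x. ennreal (x powr (- \<gamma>)) * indicator {1..} x \<partial>lborel) = ennreal (- (1 powr (- \<gamma> + 1)) / (- \<gamma> + 1))"
    using assms by (intro nn_integral_has_integral_lebesgue' has_integral_powr_to_inf) auto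
  ultimately have fin: "(\<integral>\<^sup>+x. ennreal (x powr (- \<beta>)) * indicator {0..1} x + ennreal (x powr (- \<gamma>)) * indicator {1..} x \<partial>lborel) < \<infinity>"
    by (subst nn_integral_add) auto
  have "(\<integral>\<^sup>+x. ennreal (two_powers \<beta> \<gamma> x) \<partial>lborel) \<le>
    (\<integral>\<^sup>+x. ennreal (x powr (- \<beta>)) * indicator {0..1} x + ennreal (x powr (- \<gamma>)) * indicator {1..} x \<partial>lborel)"
    by (intro nn_integral_mono) (auto simp: two_powers_def split: split_indicator)
  then show ?thesis using fin by (rule le_less_trans)
qed

lemma inverse_one_plus_le_powr:
  fixes y p :: real
  assumes "0 < y" "0 \<le> p" "p \<le> 1"
  shows "1 / (1 + y) \<le> y powr (- p)"
proof -
  have "y powr p \<le> 1 + y"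
  proof (cases "y \<le> 1")
    case True
    then have "y powr p \<le> y powr 0" using assms by (intro powr_mono') auto
    then show ?thesis using assms by simp
  next
    case False
    then have "y powr p \<le> y powr 1" using assms by (intro powr_mono) auto
    then show ?thesis using assms by simp
  qed
  then show ?thesis using assms by (simp add: powr_minus field_simps)
qed

text \<open>
  Let \<open>N = card J\<close> and let \<open>x m\<close> be the largest coordinate. If it is at most \<open>1\<close>, the right-hand side
  is at least \<open>1\<close>. Otherwise \<open>1 / (1 + y) \<le> y powr - p\<close> is used with an exponent \<open>p\<close> such that
  \<open>p * b < 1\<close>, for integrability near \<open>0\<close> in the small coordinates, and \<open>p * (A + (N - 1) * b) > N\<close>,
  for integrability at infinity. Such a \<open>p\<close> exists because \<open>b < A\<close>, and it is below \<open>1\<close> because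
  \<open>1 \<le> b\<close>. The surplus decay in
  \<open>x m\<close> is handed out to the other coordinates: since \<open>x j \<le> x m\<close>, a factor \<open>x m powr - \<delta>\<close> may be
  replaced by \<open>x j powr - \<delta>\<close>, which makes those factors integrable at infinity as well.
\<close>

lemma monomial_decay_majorant:
  fixes A b c :: real and J :: "'i set"
  assumes J: "finite J" "J \<noteq> {}" and "1 \<le> b" "b < A" "0 < c"
  obtains C \<alpha> \<beta> \<gamma> :: real where "0 < C" "1 < \<alpha>" "\<beta> < 1" "1 < \<gamma>"
    and "\<And>x m. \<lbrakk>m \<in> J; \<And>j. j \<in> J \<Longrightarrow> 0 < x j; \<And>j. j \<in> J \<Longrightarrow> x j \<le> x m\<rbrakk> \<Longrightarrow>
       1 / (1 + c * (x m powr A * (\<Prod>j\<in>J - {m}. x j powr b)))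
         \<le> C * (two_powers 0 \<alpha> (x m) * (\<Prod>j\<in>J - {m}. two_powers \<beta> \<gamma> (x j)))"
proof -
  define N where "N = real (card J)"
  have N: "1 \<le> N" using J by (simp add: N_def Suc_le_eq card_gt_0_iff)
  define D where "D = A + (N - 1) * b"
  have "N * b < D" using assms by (simp add: D_def algebra_simps)
  moreover have Dpos: "0 < D" using assms N by (auto simp: D_def intro!: add_pos_nonneg)
  ultimately have "N / D < 1 / b" using assms by (simp add: field_simps)
  then obtain p where p: "N / D < p" "p < 1 / b" using dense by blast
  have p0: "0 < p" using p(1) N Dpos by (smt (verit) divide_nonneg_nonneg)
  have pb: "p * b < 1" using p(2) assms by (simp add: field_simps)
  have "p * 1 \<le> p * b" using p0 assms by (intro mult_left_mono) auto
  then have p1: "p \<le> 1" using pb by linarith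
  have pD: "N < p * D" using p(1) Dpos by (simp add: field_simps)
  \<comment> \<open>Chosen such that the exponent \<open>\<alpha>\<close> left for \<open>x m\<close> equals \<open>1 + \<epsilon>\<close>.\<close>
  define \<epsilon> where "\<epsilon> = (p * D - N) / N"
  have \<epsilon>: "0 < \<epsilon>" using pD N by (simp add: \<epsilon>_def)
  define \<delta> where "\<delta> = 1 - p * b + \<epsilon>"
  define \<alpha> where "\<alpha> = p * A - (N - 1) * \<delta>"
  have "\<alpha> = 1 + \<epsilon>"
    using N by (simp add: \<alpha>_def \<delta>_def \<epsilon>_def D_def field_simps)
  then have \<alpha>: "1 < \<alpha>" using \<epsilon> by simp
  define C where "C = max 1 (c powr (- p))"
  have C: "1 \<le> C" "c powr (- p) \<le> C" by (auto simp: C_def)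
  have \<delta>0: "0 < \<delta>" using pb \<epsilon> by (simp add: \<delta>_def)
  show ?thesis
  proof (rule that[of C \<alpha> "p * b" "p * b + \<delta>"])
    fix x :: "'i \<Rightarrow> real" and m
    assume m: "m \<in> J" and pos: "\<And>j. j \<in> J \<Longrightarrow> 0 < x j" and max: "\<And>j. j \<in> J \<Longrightarrow> x j \<le> x m"
    let ?J = "J - {m}"
    let ?Z = "x m powr A * (\<Prod>j\<in>?J. x j powr b)"
    let ?T = "two_powers 0 \<alpha> (x m) * (\<Prod>j\<in>?J. two_powers (p * b) (p * b + \<delta>) (x j))"
    have Zpos: "0 < ?Z" using m by (auto intro!: mult_pos_pos prod_pos dest: pos)
    have T0: "0 \<le> ?T" by (intro mult_nonneg_nonneg prod_nonneg) auto
    show "1 / (1 + c * ?Z) \<le> C * ?T"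
    proof (cases "x m \<le> 1")
      case True
      have "1 * 1 \<le> ?T"
      proof (intro mult_mono)
        show "1 \<le> two_powers 0 \<alpha> (x m)" using True pos m by (intro two_powers_ge_1) auto
        show "1 \<le> (\<Prod>j\<in>?J. two_powers (p * b) (p * b + \<delta>) (x j))"
          using True pos max p0 assms by (intro prod_ge_1 two_powers_ge_1) (auto intro: order_trans)
      qed auto
      then have "1 \<le> C * ?T" using C mult_mono[of 1 C 1 ?T] by simp
      moreover have "1 / (1 + c * ?Z) \<le> 1"
        using mult_pos_pos[OF assms(5) Zpos] by (subst divide_le_eq_1_pos) linarith+
      ultimately show ?thesis by linarith
    next
      case False
      then have xm: "1 < x m" by simp
      have each: "x j powr (- (p * b)) * x m powr (- \<delta>) \<le> two_powers (p * b) (p * b + \<delta>) (x j)"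
        if "j \<in> J" for j
      proof (cases "x j \<le> 1")
        case True
        have "x m powr (- \<delta>) \<le> 1" using xm \<delta>0 powr_mono[of "-\<delta>" 0 "x m"] by simp
        then have "x j powr (- (p * b)) * x m powr (- \<delta>) \<le> x j powr (- (p * b))"
          by (intro mult_left_le) auto
        then show ?thesis using True pos[OF that] by (simp add: two_powers_def)
      next
        case False
        then have "x m powr (- \<delta>) \<le> x j powr (- \<delta>)"
          using max[OF that] \<delta>0 by (intro powr_mono2') auto
        then have "x j powr (- (p * b)) * x m powr (- \<delta>) \<le> x j powr (- (p * b)) * x j powr (- \<delta>)"
          by (intro mult_left_mono) auto
        then show ?thesis using False by (simp add: two_powers_def powr_add[symmetric])
      qed
      have cardJ: "real (card ?J) = N - 1" using m J N by (simp add: N_def of_nat_diff)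
      have "1 / (1 + c * ?Z) \<le> (c * ?Z) powr (- p)"
        using Zpos assms p0 p1 by (intro inverse_one_plus_le_powr) auto
      also have "\<dots> = c powr (- p) * (x m powr (- (p * A)) * (\<Prod>j\<in>?J. x j powr (- (p * b))))"
        using assms pos
        by (simp add: powr_mult prod_nonneg powr_powr prod_powr_distrib mult.commute)
      also have "x m powr (- (p * A)) = x m powr (- \<alpha>) * (\<Prod>j\<in>?J. x m powr (- \<delta>))"
      proof -
        have "(\<Prod>j\<in>?J. x m powr (- \<delta>)) = x m powr (- \<delta> * (N - 1))"
          using xm cardJ powr_power[of "x m" "-\<delta>" "card ?J"] by (simp add: mult.commute)
        then show ?thesis
          by (simp add: powr_add[symmetric] \<alpha>_def algebra_simps)
      qed
      also have "x m powr (- \<alpha>) * (\<Prod>j\<in>?J. x m powr (- \<delta>)) * (\<Prod>j\<in>?J. x j powr (- (p * b))) =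
          x m powr (- \<alpha>) * (\<Prod>j\<in>?J. x j powr (- (p * b)) * x m powr (- \<delta>))"
        by (simp add: prod.distrib mult_ac)
      also have "x m powr (- \<alpha>) = two_powers 0 \<alpha> (x m)"
        using xm by (simp add: two_powers_def)
      also have "c powr (- p) * (two_powers 0 \<alpha> (x m) * (\<Prod>j\<in>?J. x j powr (- (p * b)) * x m powr (- \<delta>))) \<le> C * ?T"
        using C each by (intro mult_mono mult_left_mono prod_mono mult_nonneg_nonneg prod_nonneg) auto
      finally show ?thesis .
    qed
  qed (use C \<alpha> pb \<epsilon> in \<open>auto simp: \<delta>_def\<close>)
qed

definition pos_orthant :: "'i set \<Rightarrow> ('i \<Rightarrow> real) set" where
  "pos_orthant J = J \<rightarrow>\<^sub>E {0<..}"

lemma pos_orthant_measurable [measurable]: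
  "finite J \<Longrightarrow> pos_orthant J \<in> sets (\<Pi>\<^sub>M i\<in>J. lborel)"
  unfolding pos_orthant_def by (rule sets_PiM_I_finite) auto

lemma nn_integral_product_scaled:
  fixes f :: "'i \<Rightarrow> real \<Rightarrow> real"
  assumes "finite J" "\<And>j. j \<in> J \<Longrightarrow> f j \<in> borel_measurable borel" "\<And>j x. j \<in> J \<Longrightarrow> 0 \<le> f j x" "0 < \<rho>"
  shows "(\<integral>\<^sup>+x. ennreal (\<Prod>j\<in>J. f j (x j / \<rho>)) \<partial>(\<Pi>\<^sub>M i\<in>J. lborel)) =
    ennreal (\<rho> ^ card J) * (\<Prod>j\<in>J. \<integral>\<^sup>+y. ennreal (f j y) \<partial>lborel)"
proof -
  interpret product_sigma_finite "\<lambda>i::'i. lborel :: real measure" by standard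
  have "(\<integral>\<^sup>+x. ennreal (\<Prod>j\<in>J. f j (x j / \<rho>)) \<partial>(\<Pi>\<^sub>M i\<in>J. lborel)) =
      (\<integral>\<^sup>+x. (\<Prod>j\<in>J. ennreal (f j (x j / \<rho>))) \<partial>(\<Pi>\<^sub>M i\<in>J. lborel))"
    using assms(3) by (simp add: prod_ennreal)
  also have "\<dots> = (\<Prod>j\<in>J. \<integral>\<^sup>+y. ennreal (f j (y / \<rho>)) \<partial>lborel)"
    using assms by (subst product_nn_integral_prod[where f = "\<lambda>j y. ennreal (f j (y / \<rho>))"]) auto
  also have "\<dots> = (\<Prod>j\<in>J. ennreal \<rho> * (\<integral>\<^sup>+y. ennreal (f j y) \<partial>lborel))"
  proof (intro prod.cong refl)
    fix j assume j: "j \<in> J"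
    have [measurable]: "f j \<in> borel_measurable borel" using assms j by auto
    show "(\<integral>\<^sup>+y. ennreal (f j (y / \<rho>)) \<partial>lborel) = ennreal \<rho> * (\<integral>\<^sup>+y. ennreal (f j y) \<partial>lborel)"
      using assms(4) by (subst nn_integral_real_affine[where c = \<rho> and t = 0]) auto
  qed
  also have "\<dots> = ennreal (\<rho> ^ card J) * (\<Prod>j\<in>J. \<integral>\<^sup>+y. ennreal (f j y) \<partial>lborel)"
    using assms by (simp add: prod.distrib ennreal_power)
  finally show ?thesis .
qed

text \<open>
  The constant is uniform in the scale \<open>\<rho>\<close>, and the bound carries the exact Jacobian
  \<open>\<rho> ^ card J\<close>. Boundary slices need this: their scale depends on the frozen coordinate.
\<close>

lemma nn_integral_monomial_decay:
  fixes A b c :: real and J :: "'i set"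
  assumes J: "finite J" "J \<noteq> {}" and Abc: "1 \<le> b" "b < A" "0 < c"
  obtains C :: real where "0 \<le> C"
    and "\<And>\<rho> g. \<lbrakk>0 < \<rho>; \<And>x m. \<lbrakk>x \<in> pos_orthant J; m \<in> J; \<And>j. j \<in> J \<Longrightarrow> x j \<le> x m\<rbrakk> \<Longrightarrow>
        g x \<le> 1 / (1 + c * ((x m / \<rho>) powr A * (\<Prod>j\<in>J - {m}. (x j / \<rho>) powr b)))\<rbrakk> \<Longrightarrow>
       (\<integral>\<^sup>+x. ennreal (g x) * indicator (pos_orthant J) x \<partial>(\<Pi>\<^sub>M i\<in>J. lborel)) \<le> ennreal (C * \<rho> ^ card J)"
proof -
  obtain C \<alpha> \<beta> \<gamma> where C: "0 < C" "1 < \<alpha>" "\<beta> < 1" "1 < \<gamma>"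
    and bound: "\<And>x m. \<lbrakk>m \<in> J; \<And>j. j \<in> J \<Longrightarrow> 0 < x j; \<And>j. j \<in> J \<Longrightarrow> x j \<le> x m\<rbrakk> \<Longrightarrow>
       1 / (1 + c * (x m powr A * (\<Prod>j\<in>J - {m}. x j powr b)))
         \<le> C * (two_powers 0 \<alpha> (x m) * (\<Prod>j\<in>J - {m}. two_powers \<beta> \<gamma> (x j)))"
    using monomial_decay_majorant[OF J Abc] by metis
  define f where "f m j = (if j = m then two_powers 0 \<alpha> else two_powers \<beta> \<gamma>)" for m j :: 'i
  have f_meas [measurable]: "f m j \<in> borel_measurable borel" for m j by (simp add: f_def)
  have f_nonneg: "0 \<le> f m j x" for m j x by (simp add: f_def)
  have f_fin: "(\<integral>\<^sup>+y. ennreal (f m j y) \<partial>lborel) < \<infinity>" for m j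
    using nn_integral_two_powers[of 0 \<alpha>] nn_integral_two_powers[of \<beta> \<gamma>] C by (simp add: f_def)
  define S where "S = (\<Sum>m\<in>J. \<Prod>j\<in>J. \<integral>\<^sup>+y. ennreal (f m j y) \<partial>lborel)"
  have "S < \<infinity>"
    using J f_fin unfolding S_def
    by (auto simp: less_top[symmetric] ennreal_prod_eq_top)
  then obtain S' where S': "S = ennreal S'" "0 \<le> S'" by (cases S) auto
  show ?thesis
  proof (rule that[of "C * S'"])
    fix \<rho> :: real and g :: "('i \<Rightarrow> real) \<Rightarrow> real"
    assume \<rho>: "0 < \<rho>"
      and g: "\<And>x m. \<lbrakk>x \<in> pos_orthant J; m \<in> J; \<And>j. j \<in> J \<Longrightarrow> x j \<le> x m\<rbrakk> \<Longrightarrow>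
        g x \<le> 1 / (1 + c * ((x m / \<rho>) powr A * (\<Prod>j\<in>J - {m}. (x j / \<rho>) powr b)))"
    have "ennreal (g x) * indicator (pos_orthant J) x \<le>
        ennreal C * (\<Sum>m\<in>J. ennreal (\<Prod>j\<in>J. f m j (x j / \<rho>)))" for x
    proof (cases "x \<in> pos_orthant J")
      case True
      then have pos: "0 < x j" if "j \<in> J" for j using that by (auto simp: pos_orthant_def)
      have "Max (x ` J) \<in> x ` J" using J by (intro Max_in) auto
      then obtain m where "m \<in> J" "x m = Max (x ` J)" by auto
      then have m: "m \<in> J" "\<And>j. j \<in> J \<Longrightarrow> x j \<le> x m" using J by auto
      have "g x \<le> 1 / (1 + c * ((x m / \<rho>) powr A * (\<Prod>j\<in>J - {m}. (x j / \<rho>) powr b)))"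
        using True m by (intro g) auto
      also have "\<dots> \<le> C * (two_powers 0 \<alpha> (x m / \<rho>) * (\<Prod>j\<in>J - {m}. two_powers \<beta> \<gamma> (x j / \<rho>)))"
        using bound[of m "\<lambda>j. x j / \<rho>"] m pos \<rho> by (auto simp: divide_right_mono)
      also have "two_powers 0 \<alpha> (x m / \<rho>) * (\<Prod>j\<in>J - {m}. two_powers \<beta> \<gamma> (x j / \<rho>)) = (\<Prod>j\<in>J. f m j (x j / \<rho>))"
        using J m by (subst (2) prod.remove[of _ m]) (auto simp: f_def)
      finally have "ennreal (g x) \<le> ennreal C * ennreal (\<Prod>j\<in>J. f m j (x j / \<rho>))"
        using C by (simp add: ennreal_mult'[symmetric] ennreal_leI)
      also have "\<dots> \<le> ennreal C * (\<Sum>m\<in>J. ennreal (\<Prod>j\<in>J. f m j (x j / \<rho>)))"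
        using m J by (intro mult_left_mono member_le_sum) auto
      finally show ?thesis using True by simp
    qed auto
    then have "(\<integral>\<^sup>+x. ennreal (g x) * indicator (pos_orthant J) x \<partial>(\<Pi>\<^sub>M i\<in>J. lborel)) \<le>
      (\<integral>\<^sup>+x. ennreal C * (\<Sum>m\<in>J. ennreal (\<Prod>j\<in>J. f m j (x j / \<rho>))) \<partial>(\<Pi>\<^sub>M i\<in>J. lborel))"
      by (intro nn_integral_mono)
    also have "\<dots> = ennreal C * (\<Sum>m\<in>J. \<integral>\<^sup>+x. ennreal (\<Prod>j\<in>J. f m j (x j / \<rho>)) \<partial>(\<Pi>\<^sub>M i\<in>J. lborel))"
      by (subst nn_integral_cmult, measurable, subst nn_integral_sum) auto
    also have "\<dots> = ennreal C * (\<Sum>m\<in>J. ennreal (\<rho> ^ card J) * (\<Prod>j\<in>J. \<integral>\<^sup>+y. ennreal (f m j y) \<partial>lborel))"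
      using J f_nonneg \<rho> by (simp add: nn_integral_product_scaled)
    also have "\<dots> = ennreal C * (ennreal (\<rho> ^ card J) * S)"
      by (simp add: S_def sum_distrib_left)
    also have "\<dots> = ennreal (C * S' * \<rho> ^ card J)"
      using C \<rho> S' by (simp add: ennreal_mult[symmetric] mult_ac)
    finally show "(\<integral>\<^sup>+x. ennreal (g x) * indicator (pos_orthant J) x \<partial>(\<Pi>\<^sub>M i\<in>J. lborel)) \<le> ennreal (C * S' * \<rho> ^ card J)" .
  qed (use C S' in auto)
qed

section \<open>The mass of the orthant and of its boundary slabs\<close>

lemma nn_integral_decay_finite:
  assumes "2 \<le> r"
  shows "(\<integral>\<^sup>+t. ennreal (1 / (1 + a_fun r t)) * indicator (pos_orthant {1..r}) t \<partial>(\<Pi>\<^sub>M i\<in>{1..r}. lborel)) < \<infinity>"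
proof -
  let ?J = "{1..r}" and ?c = "1 / c_const r"
  have J: "finite ?J" "?J \<noteq> {}" using assms by auto
  obtain C :: real where C: "\<And>\<rho> g. \<lbrakk>0 < \<rho>; \<And>x m. \<lbrakk>x \<in> pos_orthant ?J; m \<in> ?J; \<And>j. j \<in> ?J \<Longrightarrow> x j \<le> x m\<rbrakk> \<Longrightarrow>
        g x \<le> 1 / (1 + ?c * ((x m / \<rho>) powr real r * (\<Prod>j\<in>?J - {m}. (x j / \<rho>) powr (real r / 2))))\<rbrakk> \<Longrightarrow>
       (\<integral>\<^sup>+x. ennreal (g x) * indicator (pos_orthant ?J) x \<partial>(\<Pi>\<^sub>M i\<in>?J. lborel)) \<le> ennreal (C * \<rho> ^ card ?J)"
    by (rule nn_integral_monomial_decay[OF J, of "real r / 2" "real r" ?c]) (use assms c_const_pos[of r] in auto)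
  have "(\<integral>\<^sup>+t. ennreal (1 / (1 + a_fun r t)) * indicator (pos_orthant ?J) t \<partial>(\<Pi>\<^sub>M i\<in>?J. lborel)) \<le> ennreal (C * 1 ^ card ?J)"
  proof (rule C)
    fix x :: "nat \<Rightarrow> real" and m
    assume x: "x \<in> pos_orthant ?J" and m: "m \<in> ?J"
    then have pos: "\<And>i. i \<in> ?J \<Longrightarrow> 0 < x i" by (auto simp: pos_orthant_def)
    have "0 \<le> ?c * (x m powr real r * (\<Prod>j\<in>?J - {m}. x j powr (real r / 2)))"
      using c_const_pos[of r]
      by (intro mult_nonneg_nonneg prod_nonneg divide_nonneg_nonneg) auto
    moreover have "?c * (x m powr real r * (\<Prod>j\<in>?J - {m}. x j powr (real r / 2))) \<le> a_fun r x"
      using a_fun_ge_distinguished[OF m pos] by simp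
    ultimately show "1 / (1 + a_fun r x) \<le>
       1 / (1 + ?c * ((x m / 1) powr real r * (\<Prod>j\<in>?J - {m}. (x j / 1) powr (real r / 2))))"
      by (intro divide_left_mono) (auto intro!: mult_pos_pos)
  qed auto
  then show ?thesis by (rule le_less_trans) simp
qed

text \<open>
  The frozen coordinate \<open>y\<close> is absorbed into a dilation of the others. The lower bound of lemma
  \<open>a_fun_ge_slice\<close> is \<open>y\<close> times a monomial of degree \<open>D = (r - 1) (r + 2) / 2\<close>, hence equal to the same
  monomial in \<open>x j / \<rho>\<close> for \<open>\<rho> = y powr (- 1 / D)\<close>; and \<open>\<rho> ^ (r - 1) = y powr (- 2 / (r + 2))\<close>.
\<close>

lemma nn_integral_decay_slice:
  assumes r: "2 \<le> r" and i: "i \<in> {1..r}"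
  obtains C :: real where "0 \<le> C" and
    "\<And>y. 0 < y \<Longrightarrow> (\<integral>\<^sup>+x. ennreal (1 / (1 + a_fun r (x(i := y)))) * indicator (pos_orthant ({1..r} - {i})) x
        \<partial>(\<Pi>\<^sub>M i\<in>{1..r} - {i}. lborel)) \<le> ennreal (C * y powr (- (2 / (real r + 2))))"
proof -
  let ?J = "{1..r} - {i}" and ?c = "1 / c_const r"
  let ?A = "real r" and ?b = "(real r + 1) / 2"
  have card: "card ?J = r - 1" using i by simp
  have J: "finite ?J" "?J \<noteq> {}"
  proof -
    have "0 < card ?J" using card r by simp
    then show "finite ?J" "?J \<noteq> {}" by (auto simp only: card_gt_0_iff)
  qed
  obtain C :: real where C0: "0 \<le> C" and C: "\<And>\<rho> g. \<lbrakk>0 < \<rho>; \<And>x m. \<lbrakk>x \<in> pos_orthant ?J; m \<in> ?J; \<And>j. j \<in> ?J \<Longrightarrow> x j \<le> x m\<rbrakk> \<Longrightarrow>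
        g x \<le> 1 / (1 + ?c * ((x m / \<rho>) powr ?A * (\<Prod>j\<in>?J - {m}. (x j / \<rho>) powr ?b)))\<rbrakk> \<Longrightarrow>
       (\<integral>\<^sup>+x. ennreal (g x) * indicator (pos_orthant ?J) x \<partial>(\<Pi>\<^sub>M i\<in>?J. lborel)) \<le> ennreal (C * \<rho> ^ card ?J)"
    by (rule nn_integral_monomial_decay[OF J, of ?b ?A ?c]) (use r c_const_pos[of r] in auto)
  show ?thesis
  proof (rule that[OF C0])
    fix y :: real assume y: "0 < y"
    define D where "D = (real r - 1) * (real r + 2) / 2"
    have D: "0 < D" using r by (simp add: D_def)
    define \<rho> where "\<rho> = y powr (- (1 / D))"
    have \<rho>: "0 < \<rho>" using y by (simp add: \<rho>_def)
    have "(\<integral>\<^sup>+x. ennreal (1 / (1 + a_fun r (x(i := y)))) * indicator (pos_orthant ?J) x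
        \<partial>(\<Pi>\<^sub>M i\<in>?J. lborel)) \<le> ennreal (C * \<rho> ^ card ?J)"
    proof (rule C[OF \<rho>])
      fix x :: "nat \<Rightarrow> real" and m
      assume x: "x \<in> pos_orthant ?J" and m: "m \<in> ?J"
      let ?t = "x(i := y)"
      have pos: "0 < ?t j" if "j \<in> {1..r}" for j
        using that x y by (auto simp: pos_orthant_def PiE_def Pi_def)
      let ?Z = "x m powr ?A * (\<Prod>j\<in>?J - {m}. x j powr ?b)"
      have scale: "(x m / \<rho>) powr ?A * (\<Prod>j\<in>?J - {m}. (x j / \<rho>) powr ?b) = y * ?Z"
      proof -
        have xpos: "0 < x j" if "j \<in> ?J" for j using that pos[of j] by auto
        have "card (?J - {m}) = r - 2" using m card by simp
        then have "(\<Prod>j\<in>?J - {m}. \<rho> powr ?b) = \<rho> powr (?b * (real r - 2))"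
          using \<rho> r powr_power[of \<rho> ?b "r - 2"] by (simp add: of_nat_diff mult.commute)
        then have "\<rho> powr ?A * (\<Prod>j\<in>?J - {m}. \<rho> powr ?b) = \<rho> powr (?A + ?b * (real r - 2))"
          by (simp add: powr_add)
        also have "?A + ?b * (real r - 2) = D" by (simp add: D_def field_simps)
        also have "\<rho> powr D = y powr - 1" unfolding \<rho>_def powr_powr using D by simp
        finally have *: "\<rho> powr ?A * (\<Prod>j\<in>?J - {m}. \<rho> powr ?b) = 1 / y"
          using y by (simp add: powr_minus_divide)
        have "(x m / \<rho>) powr ?A * (\<Prod>j\<in>?J - {m}. (x j / \<rho>) powr ?b) =
            ?Z / (\<rho> powr ?A * (\<Prod>j\<in>?J - {m}. \<rho> powr ?b))"
          using \<rho> xpos m by (simp add: powr_divide less_imp_le prod_dividef)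
        then show ?thesis unfolding * using y by simp
      qed
      moreover have "?c * (y * ?Z) \<le> a_fun r ?t"
      proof -
        have "(\<Prod>j\<in>?J - {m}. ?t j powr ?b) = (\<Prod>j\<in>?J - {m}. x j powr ?b)"
          by (intro prod.cong) auto
        then show ?thesis using a_fun_ge_slice[OF i m, of ?t] pos m by simp
      qed
      moreover have "0 \<le> ?c * (y * ?Z)"
        using c_const_pos[of r] y
        by (intro mult_nonneg_nonneg prod_nonneg divide_nonneg_nonneg) auto
      ultimately show "1 / (1 + a_fun r ?t) \<le>
          1 / (1 + ?c * ((x m / \<rho>) powr ?A * (\<Prod>j\<in>?J - {m}. (x j / \<rho>) powr ?b)))"
        unfolding scale by (intro divide_left_mono mult_pos_pos) linarith+
    qed
    also have "\<rho> ^ card ?J = y powr (- (2 / (real r + 2)))"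
    proof -
      have "\<rho> ^ card ?J = y powr (- (1 / D) * (real r - 1))"
        using r y powr_power[of y "- (1 / D)" "r - 1"] unfolding card \<rho>_def
        by (simp add: of_nat_diff mult.commute)
      also have "- (1 / D) * (real r - 1) = - (2 / (real r + 2))"
      proof -
        have "real r - 1 \<noteq> 0" using r by simp
        then show ?thesis by (simp add: D_def divide_simps)
      qed
      finally show ?thesis .
    qed
    finally show "(\<integral>\<^sup>+x. ennreal (1 / (1 + a_fun r (x(i := y)))) * indicator (pos_orthant ?J) x
        \<partial>(\<Pi>\<^sub>M i\<in>?J. lborel)) \<le> ennreal (C * y powr (- (2 / (real r + 2))))" .
  qed
qed

text \<open>
  The slice bound \<open>y powr (- 2 / (r + 2))\<close> integrates to a multiple of \<open>s powr (r / (r + 2))\<close>.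
  For \<open>r = 2\<close> the exponent \<open>r / (r + 2)\<close> equals \<open>1 / r\<close>.
\<close>

lemma nn_integral_decay_boundary:
  assumes r: "2 \<le> r" and i: "i \<in> {1..r}"
  obtains C :: real where "0 \<le> C" and
    "\<And>s. \<lbrakk>0 < s; s \<le> 1\<rbrakk> \<Longrightarrow>
      (\<integral>\<^sup>+t. ennreal (1 / (1 + a_fun r t)) * indicator (pos_orthant {1..r}) t * indicator {t. t i < s} t
        \<partial>(\<Pi>\<^sub>M i\<in>{1..r}. lborel)) \<le> ennreal (C * s powr (1 / real r))"
proof -
  let ?J = "{1..r} - {i}"
  obtain C :: real where C0: "0 \<le> C" and slice:
    "\<And>y. 0 < y \<Longrightarrow> (\<integral>\<^sup>+x. ennreal (1 / (1 + a_fun r (x(i := y)))) * indicator (pos_orthant ?J) x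
        \<partial>(\<Pi>\<^sub>M i\<in>?J. lborel)) \<le> ennreal (C * y powr (- (2 / (real r + 2))))"
    by (rule nn_integral_decay_slice[OF assms]) blast
  let ?e = "- (2 / (real r + 2))"
  have e: "?e + 1 = real r / (real r + 2)" by (simp add: field_simps)
  have e_ge: "1 / real r \<le> real r / (real r + 2)"
  proof -
    have "2 * real r \<le> real r * real r" using r by (intro mult_right_mono) auto
    then have "real r + 2 \<le> real r * real r" using r by linarith
    then show ?thesis using r by (simp add: field_simps)
  qed
  interpret product_sigma_finite "\<lambda>i::nat. lborel :: real measure" by standard
  show ?thesis
  proof (rule that[of "C * ((real r + 2) / real r)"])
    fix s :: real assume s: "0 < s" "s \<le> 1"
    let ?F = "\<lambda>t. ennreal (1 / (1 + a_fun r t)) * indicator (pos_orthant {1..r}) t * indicator {t. t i < s} t"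
    have ins: "insert i ?J = {1..r}" using i by auto
    have [measurable]: "(\<lambda>t. t i) \<in> borel_measurable (\<Pi>\<^sub>M i\<in>{1..r}. lborel :: real measure)"
      using measurable_component_singleton[of i "{1..r}" "\<lambda>_. lborel :: real measure"] i by auto
    have F_meas: "?F \<in> borel_measurable (\<Pi>\<^sub>M i\<in>{1..r}. lborel)"
      unfolding indicator_def[of "{t. t i < s}"] by measurable
    have "(\<integral>\<^sup>+t. ?F t \<partial>(\<Pi>\<^sub>M i\<in>{1..r}. lborel)) =
        (\<integral>\<^sup>+y. \<integral>\<^sup>+x. ?F (x(i := y)) \<partial>(\<Pi>\<^sub>M i\<in>?J. lborel) \<partial>lborel)"
      using F_meas by (intro product_nn_integral_insert_rev[of ?J i ?F, unfolded ins]) auto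
    also have "\<dots> \<le> (\<integral>\<^sup>+y. ennreal C * (ennreal (y powr ?e) * indicator {0..s} y) \<partial>lborel)"
    proof (rule nn_integral_mono)
      fix y :: real
      show "(\<integral>\<^sup>+x. ?F (x(i := y)) \<partial>(\<Pi>\<^sub>M i\<in>?J. lborel)) \<le>
          ennreal C * (ennreal (y powr ?e) * indicator {0..s} y)"
      proof (cases "0 < y \<and> y < s")
        case True
        have "(\<integral>\<^sup>+x. ?F (x(i := y)) \<partial>(\<Pi>\<^sub>M i\<in>?J. lborel)) \<le>
           (\<integral>\<^sup>+x. ennreal (1 / (1 + a_fun r (x(i := y)))) * indicator (pos_orthant ?J) x \<partial>(\<Pi>\<^sub>M i\<in>?J. lborel))"
        proof (rule nn_integral_mono)
          fix x assume x: "x \<in> space (\<Pi>\<^sub>M i\<in>?J. lborel :: real measure)"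
          have "x \<in> pos_orthant ?J" if "x(i := y) \<in> pos_orthant {1..r}"
          proof -
            have "0 < x j" if "j \<in> ?J" for j
              using PiE_mem[OF \<open>x(i := y) \<in> pos_orthant {1..r}\<close>[unfolded pos_orthant_def], of j] that
              by (auto split: if_splits)
            then show ?thesis using x by (auto simp: pos_orthant_def space_PiM PiE_def)
          qed
          then show "?F (x(i := y)) \<le>
              ennreal (1 / (1 + a_fun r (x(i := y)))) * indicator (pos_orthant ?J) x"
            by (auto split: split_indicator)
        qed
        also have "\<dots> \<le> ennreal (C * y powr ?e)" using True by (intro slice) auto
        finally show ?thesis using True C0 by (simp add: ennreal_mult)
      next
        case False
        then have "?F (x(i := y)) = 0" for x
          using i by (auto simp: pos_orthant_def PiE_def Pi_def split: split_indicator)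
        then have "(\<integral>\<^sup>+x. ?F (x(i := y)) \<partial>(\<Pi>\<^sub>M i\<in>?J. lborel)) = (\<integral>\<^sup>+x. 0 \<partial>(\<Pi>\<^sub>M i\<in>?J. lborel :: real measure))"
          by (intro nn_integral_cong)
        then show ?thesis by (simp only: nn_integral_const mult_zero_left zero_le)
      qed
    qed
    also have "\<dots> = ennreal C * (\<integral>\<^sup>+y. ennreal (y powr ?e) * indicator {0..s} y \<partial>lborel)"
      by (rule nn_integral_cmult) auto
    also have "(\<integral>\<^sup>+y. ennreal (y powr ?e) * indicator {0..s} y \<partial>lborel) = ennreal (s powr (?e + 1) / (?e + 1))"
      using s r by (intro nn_integral_has_integral_lebesgue' has_integral_powr_from_0) auto
    also have "ennreal C * \<dots> = ennreal (C * ((real r + 2) / real r) * s powr (real r / (real r + 2)))"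
      unfolding e using C0 by (simp add: ennreal_mult[symmetric])
    also have "\<dots> \<le> ennreal (C * ((real r + 2) / real r) * s powr (1 / real r))"
      using s C0 e_ge by (intro ennreal_leI mult_left_mono powr_mono') auto
    finally show "(\<integral>\<^sup>+t. ?F t \<partial>(\<Pi>\<^sub>M i\<in>{1..r}. lborel)) \<le> ennreal (C * ((real r + 2) / real r) * s powr (1 / real r))" .
  qed (use C0 in auto)
qed

section \<open>Lattice sums of coordinatewise decreasing functions\<close>

text \<open>
  The value at the lattice point \<open>s k\<close> is compared with the cube of side \<open>s\<close> of which \<open>s k\<close> is the
  upper corner. These cubes are disjoint and contained in the orthant.
\<close>

lemma lattice_sum_le_nn_integral:
  fixes f :: "('i \<Rightarrow> real) \<Rightarrow> ennreal"
  assumes I: "finite I" and [measurable]: "f \<in> borel_measurable (\<Pi>\<^sub>M i\<in>I. lborel)"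
    and anti: "\<And>t t'. \<lbrakk>t \<in> pos_orthant I; t' \<in> pos_orthant I; \<And>i. i \<in> I \<Longrightarrow> t i \<le> t' i\<rbrakk> \<Longrightarrow> f t' \<le> f t"
    and s: "0 < s"
  shows "ennreal (s ^ card I) * (\<integral>\<^sup>+k. f (\<lambda>i\<in>I. s * real (k i)) \<partial>count_space (I \<rightarrow>\<^sub>E {1..}))
    \<le> (\<integral>\<^sup>+t. f t * indicator (pos_orthant I) t \<partial>(\<Pi>\<^sub>M i\<in>I. lborel))"
proof -
  let ?N = "I \<rightarrow>\<^sub>E {1::nat..}" and ?M = "\<Pi>\<^sub>M i\<in>I. lborel :: real measure"
  interpret product_sigma_finite "\<lambda>i::'i. lborel :: real measure" by standard
  define p where "p k = (\<lambda>i\<in>I. s * real (k i))" for k :: "'i \<Rightarrow> nat"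
  define Q where "Q k = (\<Pi>\<^sub>E i\<in>I. {s * (real (k i) - 1)<..s * real (k i)})" for k :: "'i \<Rightarrow> nat"
  have Q_meas [measurable]: "Q k \<in> sets ?M" for k
    unfolding Q_def using I by (intro sets_PiM_I_finite) auto
  have vol: "emeasure ?M (Q k) = ennreal (s ^ card I)" for k
    unfolding Q_def using I s
    by (subst emeasure_PiM) (auto simp: algebra_simps ennreal_power)
  have count: "countable ?N" using I by (intro countable_PiE) auto
  have p_pos: "p k \<in> pos_orthant I" if "k \<in> ?N" for k
  proof -
    have "1 \<le> k i" if "i \<in> I" for i using PiE_mem[OF \<open>k \<in> ?N\<close> that] by simp
    then show ?thesis using s by (force simp: p_def pos_orthant_def)
  qed
  have Q_pos: "t \<in> pos_orthant I" if "t \<in> Q k" "k \<in> ?N" for t k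
  proof -
    have "0 < t i" if i: "i \<in> I" for i
    proof -
      have "1 \<le> real (k i)" using PiE_mem[OF \<open>k \<in> ?N\<close> i] by simp
      then have "0 \<le> s * (real (k i) - 1)" using s by simp
      moreover have "s * (real (k i) - 1) < t i" using PiE_mem[OF \<open>t \<in> Q k\<close>[unfolded Q_def] i] by simp
      ultimately show ?thesis by linarith
    qed
    then show ?thesis using \<open>t \<in> Q k\<close> by (auto simp: pos_orthant_def Q_def PiE_def)
  qed
  have one: "(\<integral>\<^sup>+k. indicator (Q k) t \<partial>count_space ?N) \<le> (1::ennreal)" for t
  proof -
    \<comment> \<open>The only cube that can contain \<open>t\<close>.\<close>
    define k0 where "k0 = (\<lambda>i\<in>I. nat \<lceil>t i / s\<rceil>)"
    have "k = k0" if "t \<in> Q k" "k \<in> ?N" for k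
    proof (rule PiE_ext[of _ I "\<lambda>_. UNIV"])
      fix i assume i: "i \<in> I"
      have "s * (real (k i) - 1) < t i" "t i \<le> s * real (k i)"
        using PiE_mem[OF that(1)[unfolded Q_def] i] by auto
      then have "\<lceil>t i / s\<rceil> = int (k i)"
        using s by (intro ceiling_unique) (auto simp: field_simps)
      then show "k i = k0 i" using i by (simp add: k0_def)
    qed (use that in \<open>auto simp: k0_def PiE_def\<close>)
    then have "(\<integral>\<^sup>+k. indicator (Q k) t \<partial>count_space ?N) \<le> (\<integral>\<^sup>+k. indicator ({k0} \<inter> ?N) k \<partial>count_space ?N)"
      by (intro nn_integral_mono) (auto split: split_indicator)
    also have "\<dots> = emeasure (count_space ?N) ({k0} \<inter> ?N)" by (rule nn_integral_indicator) simp
    also have "\<dots> \<le> 1" by (cases "k0 \<in> ?N") auto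
    finally show ?thesis .
  qed
  have "ennreal (s ^ card I) * (\<integral>\<^sup>+k. f (p k) \<partial>count_space ?N) =
      (\<integral>\<^sup>+k. f (p k) * emeasure ?M (Q k) \<partial>count_space ?N)"
    by (subst nn_integral_cmult[symmetric]) (auto simp: vol mult.commute)
  also have "\<dots> = (\<integral>\<^sup>+k. \<integral>\<^sup>+t. f (p k) * indicator (Q k) t \<partial>?M \<partial>count_space ?N)"
    by (simp add: nn_integral_cmult)
  also have "\<dots> \<le> (\<integral>\<^sup>+k. \<integral>\<^sup>+t. f t * indicator (pos_orthant I) t * indicator (Q k) t \<partial>?M \<partial>count_space ?N)"
  proof (intro nn_integral_mono)
    fix k t assume k: "k \<in> space (count_space ?N)"
    show "f (p k) * indicator (Q k) t \<le> f t * indicator (pos_orthant I) t * indicator (Q k) t"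
    proof (cases "t \<in> Q k")
      case True
      have "t i \<le> p k i" if "i \<in> I" for i
        using PiE_mem[OF True[unfolded Q_def] that] that by (simp add: p_def)
      then have "f (p k) \<le> f t" using True k p_pos Q_pos by (intro anti) auto
      then show ?thesis using True k Q_pos by simp
    qed simp
  qed
  also have "\<dots> = (\<integral>\<^sup>+t. \<integral>\<^sup>+k. f t * indicator (pos_orthant I) t * indicator (Q k) t \<partial>count_space ?N \<partial>?M)"
    using count I by (intro nn_integral_count_space_nn_integral[symmetric]) measurable
  also have "\<dots> = (\<integral>\<^sup>+t. f t * indicator (pos_orthant I) t * (\<integral>\<^sup>+k. indicator (Q k) t \<partial>count_space ?N) \<partial>?M)"
    by (intro nn_integral_cong nn_integral_cmult) simp
  also have "\<dots> \<le> (\<integral>\<^sup>+t. f t * indicator (pos_orthant I) t * 1 \<partial>?M)"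
    using one by (intro nn_integral_mono mult_left_mono) auto
  finally show ?thesis by (simp add: p_def)
qed

text \<open>
  Here \<open>s k\<close> is the lower corner of its cube. The cubes then cover only the points with all
  coordinates at least \<open>s\<close>; the remaining points lie in one of the slabs \<open>{t. t i < s}\<close>.
\<close>

lemma nn_integral_le_lattice_sum:
  fixes f :: "('i \<Rightarrow> real) \<Rightarrow> ennreal"
  assumes I: "finite I" and [measurable]: "f \<in> borel_measurable (\<Pi>\<^sub>M i\<in>I. lborel)"
    and anti: "\<And>t t'. \<lbrakk>t \<in> pos_orthant I; t' \<in> pos_orthant I; \<And>i. i \<in> I \<Longrightarrow> t i \<le> t' i\<rbrakk> \<Longrightarrow> f t' \<le> f t"
    and s: "0 < s"
  shows "(\<integral>\<^sup>+t. f t * indicator (pos_orthant I) t \<partial>(\<Pi>\<^sub>M i\<in>I. lborel))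
    \<le> ennreal (s ^ card I) * (\<integral>\<^sup>+k. f (\<lambda>i\<in>I. s * real (k i)) \<partial>count_space (I \<rightarrow>\<^sub>E {1..}))
      + (\<Sum>i\<in>I. \<integral>\<^sup>+t. f t * indicator (pos_orthant I) t * indicator {t. t i < s} t \<partial>(\<Pi>\<^sub>M i\<in>I. lborel))"
proof -
  let ?N = "I \<rightarrow>\<^sub>E {1::nat..}" and ?M = "\<Pi>\<^sub>M i\<in>I. lborel :: real measure"
  interpret product_sigma_finite "\<lambda>i::'i. lborel :: real measure" by standard
  define p where "p k = (\<lambda>i\<in>I. s * real (k i))" for k :: "'i \<Rightarrow> nat"
  define R where "R k = (\<Pi>\<^sub>E i\<in>I. {s * real (k i)..<s * (real (k i) + 1)})" for k :: "'i \<Rightarrow> nat"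
  have R_meas [measurable]: "R k \<in> sets ?M" for k
    unfolding R_def using I by (intro sets_PiM_I_finite) auto
  have vol: "emeasure ?M (R k) = ennreal (s ^ card I)" for k
    unfolding R_def using I s
    by (subst emeasure_PiM) (auto simp: algebra_simps ennreal_power)
  have count: "countable ?N" using I by (intro countable_PiE) auto
  have slab [measurable]: "(\<lambda>t. indicator {t. t i < s} t :: ennreal) \<in> borel_measurable ?M" if "i \<in> I" for i
  proof -
    have [measurable]: "(\<lambda>t. t i) \<in> borel_measurable ?M"
      using measurable_component_singleton[of i I "\<lambda>_. lborel :: real measure"] that by auto
    show ?thesis unfolding indicator_def by measurable
  qed
  have [measurable]: "pos_orthant I \<in> sets ?M" using I by (rule pos_orthant_measurable)
  have slab_term: "(\<lambda>t. f t * indicator (pos_orthant I) t * indicator {t. t i < s} t) \<in> borel_measurable ?M"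
    if "i \<in> I" for i
    by (rule borel_measurable_times_ennreal[OF _ slab[OF that]]) measurable
  have sum_eq: "(\<integral>\<^sup>+t. (\<Sum>i\<in>I. f t * indicator (pos_orthant I) t * indicator {t. t i < s} t) \<partial>?M) =
      (\<Sum>i\<in>I. \<integral>\<^sup>+t. f t * indicator (pos_orthant I) t * indicator {t. t i < s} t \<partial>?M)"
    by (rule nn_integral_sum[OF slab_term])
  have "f t * indicator (pos_orthant I) t \<le> (\<integral>\<^sup>+k. f (p k) * indicator (R k) t \<partial>count_space ?N)
      + (\<Sum>i\<in>I. f t * indicator (pos_orthant I) t * indicator {t. t i < s} t)" for t
  proof (cases "t \<in> pos_orthant I \<and> (\<forall>i\<in>I. s \<le> t i)")
    case True
    define k where "k = (\<lambda>i\<in>I. nat \<lfloor>t i / s\<rfloor>)"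
    have k1: "1 \<le> \<lfloor>t i / s\<rfloor>" if "i \<in> I" for i using True that s by (simp add: le_floor_iff)
    have k: "k \<in> ?N" using k1 by (force simp: k_def le_nat_iff)
    have cube: "s * real (k i) \<le> t i" "t i < s * (real (k i) + 1)" if "i \<in> I" for i
    proof -
      have ki: "real (k i) = of_int \<lfloor>t i / s\<rfloor>" using k1[OF that] that by (simp add: k_def)
      have st: "s * (t i / s) = t i" using s by simp
      have "of_int \<lfloor>t i / s\<rfloor> \<le> t i / s" "t i / s < of_int \<lfloor>t i / s\<rfloor> + 1" by linarith+
      from mult_left_mono[OF this(1), of s] mult_strict_left_mono[OF this(2) s]
      show "s * real (k i) \<le> t i" "t i < s * (real (k i) + 1)"
        unfolding ki st using s by auto
    qed
    have tR: "t \<in> R k" using cube True by (auto simp: R_def pos_orthant_def PiE_def)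
    have kpos: "0 < k i" if "i \<in> I" for i using k1[OF that] that by (simp add: k_def)
    have "p k \<in> pos_orthant I" using kpos s by (auto simp: p_def pos_orthant_def)
    then have "f t \<le> f (p k)" using True cube by (intro anti) (auto simp: p_def)
    also have "\<dots> = f (p k) * indicator (R k) t" using tR by simp
    also have "\<dots> \<le> (\<integral>\<^sup>+k. f (p k) * indicator (R k) t \<partial>count_space ?N)"
      using k by (rule nn_integral_ge_point)
    finally show ?thesis using True by (simp add: add_increasing2)
  next
    case False
    show ?thesis
    proof (cases "t \<in> pos_orthant I")
      case True
      with False obtain i where i: "i \<in> I" "t i < s" by force
      have "f t * indicator (pos_orthant I) t = f t * indicator (pos_orthant I) t * indicator {t. t i < s} t"
        using i by simp
      also have "\<dots> \<le> (\<Sum>i\<in>I. f t * indicator (pos_orthant I) t * indicator {t. t i < s} t)"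
        using I i by (intro member_le_sum[of i I "\<lambda>i. f t * indicator (pos_orthant I) t * indicator {t. t i < s} t"]) auto
      finally show ?thesis by (simp add: add_increasing)
    qed simp
  qed
  note pointwise = this
  have step: "(\<lambda>t. \<integral>\<^sup>+k. f (p k) * indicator (R k) t \<partial>count_space ?N) \<in> borel_measurable ?M"
  proof -
    interpret sigma_finite_measure "count_space ?N"
      using count by (rule sigma_finite_measure_count_space_countable)
    have "(\<lambda>tk. f (p (snd tk)) * indicator (R (snd tk)) (fst tk)) \<in> borel_measurable (?M \<Otimes>\<^sub>M count_space ?N)"
      using count
      by (intro measurable_compose_countable'[where f = "\<lambda>k tk. f (p k) * indicator (R k) (fst tk)" and g = snd])
        measurable
    then show ?thesis
      by (intro borel_measurable_nn_integral) (simp add: case_prod_beta)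
  qed
  have "(\<integral>\<^sup>+t. f t * indicator (pos_orthant I) t \<partial>?M) \<le>
     (\<integral>\<^sup>+t. (\<integral>\<^sup>+k. f (p k) * indicator (R k) t \<partial>count_space ?N)
      + (\<Sum>i\<in>I. f t * indicator (pos_orthant I) t * indicator {t. t i < s} t) \<partial>?M)"
    by (intro nn_integral_mono pointwise)
  also have "\<dots> = (\<integral>\<^sup>+t. \<integral>\<^sup>+k. f (p k) * indicator (R k) t \<partial>count_space ?N \<partial>?M)
      + (\<Sum>i\<in>I. \<integral>\<^sup>+t. f t * indicator (pos_orthant I) t * indicator {t. t i < s} t \<partial>?M)"
    unfolding sum_eq[symmetric] by (rule nn_integral_add[OF step borel_measurable_sum[OF slab_term]])
  also have "(\<integral>\<^sup>+t. \<integral>\<^sup>+k. f (p k) * indicator (R k) t \<partial>count_space ?N \<partial>?M) =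
     (\<integral>\<^sup>+k. \<integral>\<^sup>+t. f (p k) * indicator (R k) t \<partial>?M \<partial>count_space ?N)"
    using count by (intro nn_integral_count_space_nn_integral) measurable
  also have "\<dots> = (\<integral>\<^sup>+k. ennreal (s ^ card I) * f (p k) \<partial>count_space ?N)"
    by (simp add: nn_integral_cmult vol mult.commute)
  also have "\<dots> = ennreal (s ^ card I) * (\<integral>\<^sup>+k. f (p k) \<partial>count_space ?N)"
    by (rule nn_integral_cmult) simp
  finally show ?thesis by (simp add: p_def)
qed

section \<open>The one-variable profiles\<close>

text \<open>
  For \<open>j = 1\<close> this is \<open>x / (exp x - 1)\<close>, as in Planck's law. At \<open>x = 0\<close> the value is \<open>0\<close>
  for \<open>j > 0\<close>, although the limit from the right is \<open>1\<close>.
\<close>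

definition planck :: "nat \<Rightarrow> real \<Rightarrow> real" where
  "planck j x = x ^ j * exp (- x) / (1 - exp (- x)) ^ j"

lemma planck_pos: "0 < x \<Longrightarrow> 0 < planck j x"
  by (simp add: planck_def)

lemma planck_nonneg: "0 \<le> x \<Longrightarrow> 0 \<le> planck j x"
  by (simp add: planck_def)

lemma planck_measurable [measurable]: "planck j \<in> borel_measurable borel"
  unfolding planck_def by measurable

lemma planck_1_eq: "0 < x \<Longrightarrow> planck 1 x = x / (exp x - 1)"
  by (simp add: planck_def exp_minus field_simps)

lemma planck_2_eq: "0 < x \<Longrightarrow> planck 2 x = (x / 2 / sinh (x / 2))\<^sup>2"
proof -
  assume x: "0 < x"
  define u where "u = exp (x / 2)"
  have u: "1 < u" using x by (simp add: u_def)
  have e: "exp (- x) = 1 / u\<^sup>2" "exp (- (x / 2)) = 1 / u"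
    by (simp_all add: u_def exp_minus power2_eq_square exp_add[symmetric] inverse_eq_divide)
  have "u * u \<noteq> 1" using u by (metis less_1_mult less_irrefl)
  then show ?thesis
    using u unfolding planck_def sinh_def e u_def[symmetric]
    by (simp add: power2_eq_square field_simps)
qed

text \<open>
  The convex function \<open>exp\<close> lies below its chord over \<open>[0, y]\<close>, so \<open>(exp x - 1) / x\<close> increases.
\<close>

lemma planck_1_antimono: "0 < x \<Longrightarrow> x \<le> y \<Longrightarrow> planck 1 y \<le> planck 1 x"
proof -
  assume x: "0 < x" and xy: "x \<le> y"
  have "exp ((1 - x / y) *\<^sub>R 0 + (x / y) *\<^sub>R y) \<le> (1 - x / y) * exp 0 + (x / y) * exp y"
    using x xy by (intro convex_onD[OF exp_convex]) auto
  then have "exp x - 1 \<le> (x / y) * (exp y - 1)"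
    using x xy by (simp add: algebra_simps)
  then have "y * (exp x - 1) \<le> x * (exp y - 1)"
    using x xy by (simp add: pos_le_divide_eq mult.commute)
  then have "y / (exp y - 1) \<le> x / (exp x - 1)"
    using x xy by (simp add: divide_le_eq le_divide_eq mult.commute)
  then show ?thesis using x xy planck_1_eq[of x] planck_1_eq[of y] by simp
qed

lemma convex_on_sinh: "convex_on {0..} (sinh :: real \<Rightarrow> real)"
  by (rule f''_ge0_imp_convex[where f' = cosh and f'' = sinh]) (auto intro!: derivative_eq_intros)

text \<open>
  Since \<open>sinh\<close> is convex on the positive half-line and vanishes at \<open>0\<close>, the quotient
  \<open>sinh x / x\<close> increases.
\<close>

lemma planck_2_antimono: "0 < x \<Longrightarrow> x \<le> y \<Longrightarrow> planck 2 y \<le> planck 2 x"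
proof -
  assume x: "0 < x" and xy: "x \<le> y"
  have "sinh ((1 - x / y) *\<^sub>R 0 + (x / y) *\<^sub>R (y / 2)) \<le> (1 - x / y) * sinh 0 + (x / y) * sinh (y / 2)"
    using x xy by (intro convex_onD[OF convex_on_sinh]) auto
  then have "y * sinh (x / 2) \<le> x * sinh (y / 2)"
    using x xy by (simp add: field_simps)
  then have "y / 2 / sinh (y / 2) \<le> x / 2 / sinh (x / 2)"
    using x xy by (simp add: field_simps)
  then show ?thesis using x xy by (simp add: planck_2_eq power_mono)
qed

lemma planck_Suc: "planck (Suc j) x = planck j x * (x / (1 - exp (- x)))"
  by (simp add: planck_def field_simps)

text \<open>
  The cubic decay leaves room for two factors \<open>1 + x\<close>, each of which raises the index by one
  (lemma \<open>planck_Suc_le\<close>).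
\<close>

lemma planck_1_le: "0 < x \<Longrightarrow> planck 1 x \<le> 24 / (1 + x) ^ 3"
proof -
  assume x: "0 < x"
  have "(\<Sum>n<5. inverse (fact n) * x ^ n) \<le> (\<Sum>n. inverse (fact n) * x ^ n)"
    using x by (intro sum_le_suminf summable_exp) auto
  also have "\<dots> = exp x" by (simp add: exp_def)
  finally have "x + x^2 / 2 + x^3 / 6 + x^4 / 24 \<le> exp x - 1"
    by (simp add: eval_nat_numeral field_simps)
  then have "24 * x + 12 * x^2 + 4 * x^3 + x^4 \<le> 24 * (exp x - 1)" by simp
  moreover have "x * (1 + x)^3 = x + 3 * x^2 + 3 * x^3 + x^4"
    by (simp add: eval_nat_numeral algebra_simps)
  moreover have "0 \<le> x" "0 \<le> x^2" "0 \<le> x^3" using x by auto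
  ultimately have "x * (1 + x)^3 \<le> 24 * (exp x - 1)" by linarith
  then have "x / (exp x - 1) \<le> 24 / (1 + x) ^ 3"
    using x by (simp add: divide_le_eq le_divide_eq)
  then show ?thesis using planck_1_eq[OF x] by simp
qed

lemma planck_Suc_le: "0 < x \<Longrightarrow> planck (Suc j) x \<le> planck j x * (1 + x)"
proof -
  assume x: "0 < x"
  have "(1 + x) * exp (- x) \<le> 1"
    using exp_ge_add_one_self[of x] by (simp add: exp_minus field_simps)
  then have "x / (1 - exp (- x)) \<le> 1 + x" using x by (simp add: field_simps)
  then show ?thesis unfolding planck_Suc
    using planck_nonneg[of x j] x by (intro mult_left_mono) auto
qed

lemma planck_le:
  assumes "0 < x" "j \<in> {1, 2, 3}"
  shows "planck j x \<le> 24 / (1 + x)"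
proof -
  have 1: "planck 1 x \<le> 24 / (1 + x) ^ 3" using assms by (intro planck_1_le)
  have "planck 2 x \<le> planck 1 x * (1 + x)"
    using planck_Suc_le[of x 1] assms by (simp add: eval_nat_numeral)
  also have "\<dots> \<le> 24 / (1 + x) ^ 3 * (1 + x)" using 1 assms by (intro mult_right_mono) auto
  also have "\<dots> = 24 / (1 + x) ^ 2"
    using assms by (simp add: power_eq_if[of _ 3] power2_eq_square divide_simps)
  finally have 2: "planck 2 x \<le> 24 / (1 + x) ^ 2" .
  have "planck 3 x \<le> planck 2 x * (1 + x)"
    using planck_Suc_le[of x 2] assms by (simp add: eval_nat_numeral)
  also have "\<dots> \<le> 24 / (1 + x) ^ 2 * (1 + x)" using 2 assms by (intro mult_right_mono) auto
  also have "\<dots> = 24 / (1 + x)"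
    using assms by (simp add: power2_eq_square divide_simps)
  finally have 3: "planck 3 x \<le> 24 / (1 + x)" .
  have "24 / (1 + x) ^ n \<le> 24 / (1 + x)" if "1 \<le> n" for n
    using assms self_le_power[of "1 + x" n] that by (intro divide_left_mono) auto
  from this[of 2] this[of 3] 1 2 3 show ?thesis using assms(2) by auto
qed

section \<open>Lattice sums of decreasing profiles of the product\<close>

lemma summable_on_nn_integral_count_space:
  fixes f :: "'a \<Rightarrow> real"
  assumes "\<And>k. k \<in> N \<Longrightarrow> 0 \<le> f k" "(\<integral>\<^sup>+k. ennreal (f k) \<partial>count_space N) < \<infinity>"
  shows "f summable_on N" "ennreal (\<Sum>\<^sub>\<infinity>k\<in>N. f k) = (\<integral>\<^sup>+k. ennreal (f k) \<partial>count_space N)"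
proof -
  have int: "integrable (count_space N) f"
    using assms by (intro integrableI_nonneg) (auto simp: AE_count_space)
  then have abs: "Infinite_Set_Sum.abs_summable_on f N"
    by (simp add: Infinite_Set_Sum.abs_summable_on_def)
  then show "f summable_on N"
    by (simp add: abs_summable_equivalent[symmetric] abs_summable_summable)
  have "infsum f N = integral\<^sup>L (count_space N) f"
    using abs infsetsum_infsum[of f N] by (simp add: infsetsum_def)
  then show "ennreal (\<Sum>\<^sub>\<infinity>k\<in>N. f k) = (\<integral>\<^sup>+k. ennreal (f k) \<partial>count_space N)"
    using int assms by (simp add: nn_integral_eq_integral AE_count_space)
qed

text \<open>
  The three profiles to which the comparison of sums and integrals is applied are \<open>planck 1\<close>,
  \<open>planck 2\<close> and, up to a constant, the majorant \<open>1 / (1 + x)\<close> of \<open>planck 3\<close>, which is not monotone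
  itself.
\<close>

locale decreasing_profile =
  fixes G :: "real \<Rightarrow> real" and B :: real
  assumes measurable_profile [measurable]: "G \<in> borel_measurable borel"
    and pos: "\<And>x. 0 < x \<Longrightarrow> 0 < G x"
    and antimono: "\<And>x y. 0 < x \<Longrightarrow> x \<le> y \<Longrightarrow> G y \<le> G x"
    and bound: "\<And>x. 0 < x \<Longrightarrow> G x \<le> B / (1 + x)"
begin

definition profile_integral :: "nat \<Rightarrow> real" where
  "profile_integral r = enn2real (\<integral>\<^sup>+t. ennreal (G (a_fun r t)) * indicator (pos_orthant {1..r}) t \<partial>(\<Pi>\<^sub>M i\<in>{1..r}. lborel))"

definition boundary_mass :: "nat \<Rightarrow> real \<Rightarrow> ennreal" where
  "boundary_mass r s = (\<Sum>i\<in>{1..r}. \<integral>\<^sup>+t. ennreal (G (a_fun r t)) * indicator (pos_orthant {1..r}) t * indicator {t. t i < s} t \<partial>(\<Pi>\<^sub>M i\<in>{1..r}. lborel))"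

definition lattice_sum :: "nat \<Rightarrow> real \<Rightarrow> real" where
  "lattice_sum r s = (\<Sum>\<^sub>\<infinity>k\<in>Npow r. G (s powr (real r * (real r + 1) / 2) * a_nat r k))"

lemma B_pos: "0 < B"
proof -
  have "0 < B / (1 + 1)" using pos[of 1] bound[of 1] by linarith
  then show ?thesis by simp
qed

lemma a_fun_pos_on_orthant: "t \<in> pos_orthant {1..r} \<Longrightarrow> 0 < a_fun r t"
  by (rule a_fun_pos) (auto simp: pos_orthant_def)

lemma profile_le_decay:
  assumes "t \<in> pos_orthant {1..r}"
  shows "ennreal (G (a_fun r t)) \<le> ennreal B * ennreal (1 / (1 + a_fun r t))"
  using bound[OF a_fun_pos_on_orthant[OF assms]] B_pos a_fun_pos_on_orthant[OF assms]
  by (subst ennreal_mult[symmetric]) (auto intro: ennreal_leI)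

lemma decay_measurable:
  "(\<lambda>t. ennreal (1 / (1 + a_fun r t)) * indicator (pos_orthant {1..r}) t) \<in> borel_measurable (\<Pi>\<^sub>M i\<in>{1..r}. lborel)"
  by measurable

lemma profile_finite:
  assumes "2 \<le> r"
  shows "(\<integral>\<^sup>+t. ennreal (G (a_fun r t)) * indicator (pos_orthant {1..r}) t \<partial>(\<Pi>\<^sub>M i\<in>{1..r}. lborel)) < \<infinity>"
proof -
  have "(\<integral>\<^sup>+t. ennreal (G (a_fun r t)) * indicator (pos_orthant {1..r}) t \<partial>(\<Pi>\<^sub>M i\<in>{1..r}. lborel))
    \<le> (\<integral>\<^sup>+t. ennreal B * (ennreal (1 / (1 + a_fun r t)) * indicator (pos_orthant {1..r}) t) \<partial>(\<Pi>\<^sub>M i\<in>{1..r}. lborel))"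
    using profile_le_decay by (intro nn_integral_mono) (auto split: split_indicator)
  also have "\<dots> = ennreal B * (\<integral>\<^sup>+t. ennreal (1 / (1 + a_fun r t)) * indicator (pos_orthant {1..r}) t \<partial>(\<Pi>\<^sub>M i\<in>{1..r}. lborel))"
    by (rule nn_integral_cmult[OF decay_measurable])
  also have "\<dots> < \<infinity>"
    using nn_integral_decay_finite[OF assms] by (simp add: ennreal_mult_less_top)
  finally show ?thesis .
qed

lemma profile_integral_eq:
  assumes "2 \<le> r"
  shows "ennreal (profile_integral r) =
    (\<integral>\<^sup>+t. ennreal (G (a_fun r t)) * indicator (pos_orthant {1..r}) t \<partial>(\<Pi>\<^sub>M i\<in>{1..r}. lborel))"
  unfolding profile_integral_def using profile_finite[OF assms] by (intro ennreal_enn2real) auto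

lemma profile_integral_nonneg: "0 \<le> profile_integral r"
  by (simp add: profile_integral_def)

lemma profile_boundary:
  assumes "2 \<le> r"
  shows "\<exists>C\<ge>0. \<forall>s. 0 < s \<longrightarrow> s \<le> 1 \<longrightarrow>
    boundary_mass r s
      \<le> ennreal (C * s powr (1 / real r))"
proof -
  let ?M = "\<Pi>\<^sub>M i\<in>{1..r}. lborel :: real measure"
  have "\<forall>i\<in>{1..r}. \<exists>C\<ge>0. \<forall>s. 0 < s \<longrightarrow> s \<le> 1 \<longrightarrow>
      (\<integral>\<^sup>+t. ennreal (1 / (1 + a_fun r t)) * indicator (pos_orthant {1..r}) t * indicator {t. t i < s} t \<partial>?M)
        \<le> ennreal (C * s powr (1 / real r))"
  proof
    fix i assume i: "i \<in> {1..r}"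
    show "\<exists>C\<ge>0. \<forall>s. 0 < s \<longrightarrow> s \<le> 1 \<longrightarrow>
      (\<integral>\<^sup>+t. ennreal (1 / (1 + a_fun r t)) * indicator (pos_orthant {1..r}) t * indicator {t. t i < s} t \<partial>?M)
        \<le> ennreal (C * s powr (1 / real r))"
      by (rule nn_integral_decay_boundary[OF assms i]) blast
  qed
  then obtain C where C0: "\<And>i. i \<in> {1..r} \<Longrightarrow> 0 \<le> C i" and C: "\<And>i s. \<lbrakk>i \<in> {1..r}; 0 < s; s \<le> 1\<rbrakk> \<Longrightarrow>
      (\<integral>\<^sup>+t. ennreal (1 / (1 + a_fun r t)) * indicator (pos_orthant {1..r}) t * indicator {t. t i < s} t \<partial>?M)
        \<le> ennreal (C i * s powr (1 / real r))"
    unfolding bchoice_iff by blast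
  show ?thesis
  proof (intro exI[of _ "\<Sum>i\<in>{1..r}. B * C i"] conjI allI impI)
    show "0 \<le> (\<Sum>i\<in>{1..r}. B * C i)" using C0 B_pos by (intro sum_nonneg) auto
    fix s :: real assume s: "0 < s" "s \<le> 1"
    have "(\<integral>\<^sup>+t. ennreal (G (a_fun r t)) * indicator (pos_orthant {1..r}) t * indicator {t. t i < s} t \<partial>?M)
        \<le> ennreal (B * C i * s powr (1 / real r))" if i: "i \<in> {1..r}" for i
    proof -
      have [measurable]: "(\<lambda>t. t i) \<in> borel_measurable ?M"
        using measurable_component_singleton[of i "{1..r}" "\<lambda>_. lborel :: real measure"] i by auto
      have meas: "(\<lambda>t. ennreal (1 / (1 + a_fun r t)) * indicator (pos_orthant {1..r}) t * indicator {t. t i < s} t)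
          \<in> borel_measurable ?M"
        unfolding indicator_def[of "{t. t i < s}"] by measurable
      have "(\<integral>\<^sup>+t. ennreal (G (a_fun r t)) * indicator (pos_orthant {1..r}) t * indicator {t. t i < s} t \<partial>?M)
        \<le> (\<integral>\<^sup>+t. ennreal B * (ennreal (1 / (1 + a_fun r t)) * indicator (pos_orthant {1..r}) t * indicator {t. t i < s} t) \<partial>?M)"
        using profile_le_decay by (intro nn_integral_mono) (auto split: split_indicator)
      also have "\<dots> = ennreal B * (\<integral>\<^sup>+t. ennreal (1 / (1 + a_fun r t)) * indicator (pos_orthant {1..r}) t * indicator {t. t i < s} t \<partial>?M)"
        by (rule nn_integral_cmult[OF meas])
      also have "\<dots> \<le> ennreal B * ennreal (C i * s powr (1 / real r))"
        using C[OF i s] by (intro mult_left_mono) auto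
      also have "\<dots> = ennreal (B * C i * s powr (1 / real r))"
        using B_pos C0[OF i] by (simp add: ennreal_mult[symmetric] mult.assoc)
      finally show ?thesis .
    qed
    then have "boundary_mass r s \<le> (\<Sum>i\<in>{1..r}. ennreal (B * C i * s powr (1 / real r)))"
      unfolding boundary_mass_def by (rule sum_mono)
    also have "\<dots> = ennreal ((\<Sum>i\<in>{1..r}. B * C i) * s powr (1 / real r))"
      using B_pos C0 by (subst sum_ennreal) (auto simp: sum_distrib_right)
    finally show "boundary_mass r s \<le> ennreal ((\<Sum>i\<in>{1..r}. B * C i) * s powr (1 / real r))" .
  qed
qed

lemma profile_antimono_orthant:
  assumes "t \<in> pos_orthant {1..r}" "t' \<in> pos_orthant {1..r}" "\<And>i. i \<in> {1..r} \<Longrightarrow> t i \<le> t' i"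
  shows "ennreal (G (a_fun r t')) \<le> ennreal (G (a_fun r t))"
proof -
  have "0 < t i" if "i \<in> {1..r}" for i
    using PiE_mem[OF assms(1)[unfolded pos_orthant_def] that] by simp
  then have "a_fun r t \<le> a_fun r t'"
    using assms(3) by (intro a_fun_mono) (auto simp: less_imp_le)
  then show ?thesis using a_fun_pos_on_orthant[OF assms(1)] by (intro ennreal_leI antimono)
qed

lemma a_fun_lattice_point:
  assumes "0 < s"
  shows "a_fun r (\<lambda>i\<in>{1..r}. s * real (k i)) = s powr (real r * (real r + 1) / 2) * a_nat r k"
proof -
  have "a_fun r (\<lambda>i\<in>{1..r}. s * real (k i)) = a_fun r (\<lambda>i. s * real (k i))"
    by (rule a_fun_cong) simp
  then show ?thesis using a_fun_scale[OF assms, of r "\<lambda>i. real (k i)"] by (simp add: a_nat_def)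
qed

lemma profile_measurable: "(\<lambda>t. ennreal (G (a_fun r t))) \<in> borel_measurable (\<Pi>\<^sub>M i\<in>{1..r}. lborel)"
  by measurable

context
  fixes r :: nat and s :: real
  assumes r: "2 \<le> r" and s: "0 < s"
begin

lemma lattice_nn_integral_le:
  "ennreal (s ^ r) * (\<integral>\<^sup>+k. ennreal (G (s powr (real r * (real r + 1) / 2) * a_nat r k)) \<partial>count_space (Npow r))
    \<le> ennreal (profile_integral r)"
proof -
  have card: "card {1..r} = r" by simp
  show ?thesis
    unfolding profile_integral_eq[OF r] Npow_def a_fun_lattice_point[OF s, symmetric]
    using profile_antimono_orthant
    by (rule lattice_sum_le_nn_integral[where I = "{1..r}" and f = "\<lambda>t. ennreal (G (a_fun r t))",
          unfolded card, OF finite_atLeastAtMost profile_measurable _ s])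
qed

lemma lattice_nn_integral_finite:
  "(\<integral>\<^sup>+k. ennreal (G (s powr (real r * (real r + 1) / 2) * a_nat r k)) \<partial>count_space (Npow r)) < \<infinity>"
proof -
  have "ennreal (s ^ r) * (\<integral>\<^sup>+k. ennreal (G (s powr (real r * (real r + 1) / 2) * a_nat r k)) \<partial>count_space (Npow r)) < \<infinity>"
    using lattice_nn_integral_le by (rule le_less_trans) simp
  then show ?thesis using s by (auto simp: ennreal_mult_less_top)
qed

lemma lattice_term_pos: "k \<in> Npow r \<Longrightarrow> 0 < G (s powr (real r * (real r + 1) / 2) * a_nat r k)"
  using s a_nat_pos by (intro pos) auto

lemma lattice_sum_summable: "(\<lambda>k. G (s powr (real r * (real r + 1) / 2) * a_nat r k)) summable_on Npow r"
  using lattice_nn_integral_finite lattice_term_pos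
  by (intro summable_on_nn_integral_count_space) (auto intro: less_imp_le)

lemma lattice_sum_eq: "ennreal (lattice_sum r s) =
    (\<integral>\<^sup>+k. ennreal (G (s powr (real r * (real r + 1) / 2) * a_nat r k)) \<partial>count_space (Npow r))"
  unfolding lattice_sum_def using lattice_nn_integral_finite lattice_term_pos
  by (intro summable_on_nn_integral_count_space) (auto intro: less_imp_le)

lemma lattice_sum_nonneg: "0 \<le> lattice_sum r s"
  unfolding lattice_sum_def using lattice_term_pos by (intro infsum_nonneg) (auto intro: less_imp_le)

lemma lattice_sum_le: "s ^ r * lattice_sum r s \<le> profile_integral r"
  using lattice_nn_integral_le lattice_sum_nonneg s profile_integral_nonneg
  unfolding lattice_sum_eq[symmetric] by (simp add: ennreal_mult[symmetric])

lemma lattice_sum_ge_term: "k \<in> Npow r \<Longrightarrow>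
    G (s powr (real r * (real r + 1) / 2) * a_nat r k) \<le> lattice_sum r s"
  unfolding lattice_sum_def using lattice_term_pos
  by (intro finite_sum_le_infsum[OF lattice_sum_summable, of "{k}", simplified])
    (auto intro: less_imp_le)

end

lemma profile_integral_pos:
  assumes r: "2 \<le> r"
  shows "0 < profile_integral r"
proof -
  have k: "(\<lambda>i\<in>{1..r}. 1) \<in> Npow r" by (auto simp: Npow_def)
  have "0 < lattice_sum r 1"
    using lattice_sum_ge_term[OF r, of 1, OF _ k] lattice_term_pos[OF r, of 1, OF _ k] by simp
  then show ?thesis using lattice_sum_le[OF r, of 1] by simp
qed

lemma profile_integral_le:
  assumes r: "2 \<le> r"
  obtains C where "0 \<le> C" "\<And>s. \<lbrakk>0 < s; s \<le> 1\<rbrakk> \<Longrightarrow>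
    profile_integral r - C * s powr (1 / real r) \<le> s ^ r * lattice_sum r s"
proof -
  obtain C where C0: "0 \<le> C" and C: "\<forall>s. 0 < s \<longrightarrow> s \<le> 1 \<longrightarrow>
    boundary_mass r s
      \<le> ennreal (C * s powr (1 / real r))"
    using profile_boundary[OF r] by blast
  show ?thesis
  proof (rule that[OF C0])
    fix s :: real assume s: "0 < s" "s \<le> 1"
    have "ennreal (profile_integral r) \<le> ennreal (s ^ r) * ennreal (lattice_sum r s) +
      boundary_mass r s"
    proof -
      have card: "card {1..r} = r" by simp
      show ?thesis
        unfolding profile_integral_eq[OF r] lattice_sum_eq[OF r s(1)] boundary_mass_def Npow_def
          a_fun_lattice_point[OF s(1), symmetric]
        using profile_antimono_orthant
        by (rule nn_integral_le_lattice_sum[where I = "{1..r}" and f = "\<lambda>t. ennreal (G (a_fun r t))",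
              unfolded card, OF finite_atLeastAtMost profile_measurable _ s(1)])
    qed
    also have "\<dots> \<le> ennreal (s ^ r) * ennreal (lattice_sum r s) + ennreal (C * s powr (1 / real r))"
      using C s by (intro add_left_mono) auto
    also have "\<dots> = ennreal (s ^ r * lattice_sum r s + C * s powr (1 / real r))"
      using lattice_sum_nonneg[OF r s(1)] s C0 by (simp add: ennreal_mult[symmetric] ennreal_plus[symmetric] del: ennreal_plus)
    finally have "profile_integral r \<le> s ^ r * lattice_sum r s + C * s powr (1 / real r)"
      using lattice_sum_nonneg[OF r s(1)] s C0 by (subst (asm) ennreal_le_iff) auto
    then show "profile_integral r - C * s powr (1 / real r) \<le> s ^ r * lattice_sum r s" by linarith
  qed
qed

lemma lattice_sum_asymptotics:
  assumes r: "2 \<le> r"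
  obtains C where "0 \<le> C" "\<And>s. \<lbrakk>0 < s; s \<le> 1\<rbrakk> \<Longrightarrow>
    1 - C * s powr (1 / real r) \<le> s ^ r * lattice_sum r s / profile_integral r"
proof -
  have I: "0 < profile_integral r" by (rule profile_integral_pos[OF r])
  obtain C where C0: "0 \<le> C" and C: "\<And>s. \<lbrakk>0 < s; s \<le> 1\<rbrakk> \<Longrightarrow>
      profile_integral r - C * s powr (1 / real r) \<le> s ^ r * lattice_sum r s"
    by (rule profile_integral_le[OF r]) blast
  show ?thesis
  proof (rule that[of "C / profile_integral r"])
    fix s :: real assume "0 < s" "s \<le> 1"
    from divide_right_mono[OF C[OF this], of "profile_integral r"] I
    show "1 - C / profile_integral r * s powr (1 / real r) \<le> s ^ r * lattice_sum r s / profile_integral r"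
      by (simp add: diff_divide_distrib)
  qed (use C0 I in auto)
qed

text \<open>
  The integral over the closed orthant agrees with the one over the open orthant because the
  integrand vanishes on the coordinate hyperplanes.
\<close>

lemma profile_orthant:
  assumes "2 \<le> r" "G 0 = 0"
  shows "set_integrable (lebesgue_pow r) (orthant r) (\<lambda>t. G (a_fun r t))"
    and "(LINT t:orthant r|lebesgue_pow r. G (a_fun r t)) = profile_integral r"
proof -
  have eq: "indicator (orthant r) t * G (a_fun r t) = G (a_fun r t) * indicator (pos_orthant {1..r}) t" for t
  proof (cases "t \<in> orthant r - pos_orthant {1..r}")
    case True
    then have t: "t \<in> orthant r" "t \<notin> pos_orthant {1..r}" by auto
    have "\<exists>i\<in>{1..r}. t i = 0"
    proof (rule ccontr)
      assume nz: "\<not> (\<exists>i\<in>{1..r}. t i = 0)"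
      have "t i \<in> {0<..}" if "i \<in> {1..r}" for i
        using PiE_mem[OF t(1)[unfolded orthant_def] that] nz that by force
      moreover have "t \<in> extensional {1..r}" using t(1) by (simp add: orthant_def PiE_iff)
      ultimately have "t \<in> pos_orthant {1..r}" by (simp only: pos_orthant_def PiE_iff) simp
      then show False using t(2) by simp
    qed
    then obtain i where i: "i \<in> {1..r}" "t i = 0" by blast
    have "(\<Prod>(l, j)\<in>ordered_pairs {1..r}. \<Sum>i=l..j. t i) = 0"
    proof (rule prod_zero)
      show "\<exists>p\<in>ordered_pairs {1..r}. (case p of (l, j) \<Rightarrow> \<Sum>i=l..j. t i) = 0"
        using i by (intro bexI[of _ "(i, i)"]) (auto simp: ordered_pairs_def)
    qed simp
    then have "a_fun r t = 0" by (simp add: a_fun_ordered_pairs)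
    then show ?thesis using True assms by simp
  next
    case False
    moreover have "pos_orthant {1..r} \<subseteq> orthant r"
      unfolding pos_orthant_def orthant_def by (intro PiE_mono) auto
    ultimately show ?thesis by (auto split: split_indicator)
  qed
  have nonneg: "0 \<le> G (a_fun r t) * indicator (pos_orthant {1..r}) t" for t
    using pos[OF a_fun_pos_on_orthant] by (auto split: split_indicator intro: less_imp_le)
  have meas: "(\<lambda>t. G (a_fun r t) * indicator (pos_orthant {1..r}) t) \<in> borel_measurable (\<Pi>\<^sub>M i\<in>{1..r}. lborel)"
    by measurable
  have enn: "(\<integral>\<^sup>+t. ennreal (G (a_fun r t) * indicator (pos_orthant {1..r}) t) \<partial>(\<Pi>\<^sub>M i\<in>{1..r}. lborel)) = ennreal (profile_integral r)"
    unfolding profile_integral_eq[OF assms(1)] by (intro nn_integral_cong) (auto split: split_indicator)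
  have "has_bochner_integral (\<Pi>\<^sub>M i\<in>{1..r}. lborel) (\<lambda>t. G (a_fun r t) * indicator (pos_orthant {1..r}) t) (profile_integral r)"
    using nonneg profile_integral_nonneg meas enn by (intro has_bochner_integral_nn_integral) auto
  then show "set_integrable (lebesgue_pow r) (orthant r) (\<lambda>t. G (a_fun r t))"
    and "(LINT t:orthant r|lebesgue_pow r. G (a_fun r t)) = profile_integral r"
    unfolding set_integrable_def set_lebesgue_integral_def lebesgue_pow_def
    by (simp_all add: eq has_bochner_integral_iff)
qed

end

section \<open>Existence and uniqueness of the saddle point\<close>

interpretation planck1: decreasing_profile "planck 1" 24
  using planck_pos[of _ 1] planck_1_antimono planck_le[of _ 1] by unfold_locales auto

interpretation planck2: decreasing_profile "planck 2" 24
  using planck_pos[of _ 2] planck_2_antimono planck_le[of _ 2] by unfold_locales auto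

interpretation decay: decreasing_profile "\<lambda>x. 1 / (1 + x)" 1
  by unfold_locales (auto intro!: divide_left_mono)

lemma planck_rescale:
  assumes "0 < w"
  shows "a ^ j * exp (- w) powr a / (1 - exp (- w) powr a) ^ j = planck j (w * a) / w ^ j"
  using assms by (simp add: planck_def exp_powr_real power_mult_distrib)

lemma scale_of_weight:
  assumes "2 \<le> r" "0 < w"
  obtains s where "0 < s" "s powr (real r * (real r + 1) / 2) = w"
proof
  have "real r * (real r + 1) / 2 \<noteq> 0" using assms by simp
  then show "(w powr (1 / (real r * (real r + 1) / 2))) powr (real r * (real r + 1) / 2) = w"
    unfolding powr_powr using assms by simp
  show "0 < w powr (1 / (real r * (real r + 1) / 2))" using assms by simp
qed

lemma ones_in_Npow: "(\<lambda>i\<in>{1..r}. 1) \<in> Npow r"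
  by (auto simp: Npow_def)

lemma size_term_eq:
  assumes "0 < w" "0 < a"
  shows "planck 1 (w * a) / w = a / (exp (w * a) - 1)"
  using assms planck_1_eq[of "w * a"] by simp

lemma size_term_antimono:
  assumes "0 < w" "w \<le> w'" "0 < a"
  shows "planck 1 (w' * a) / w' \<le> planck 1 (w * a) / w"
proof -
  have "0 < w * a" "w * a \<le> w' * a" using assms by auto
  then have "0 < exp (w * a) - 1" "exp (w * a) - 1 \<le> exp (w' * a) - 1" by auto
  then have "a / (exp (w' * a) - 1) \<le> a / (exp (w * a) - 1)"
    using assms by (intro divide_left_mono) auto
  then show ?thesis using assms by (simp add: size_term_eq del: One_nat_def)
qed

lemma size_term_strict_antimono:
  assumes "0 < w" "w < w'" "0 < a"
  shows "planck 1 (w' * a) / w' < planck 1 (w * a) / w"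
proof -
  have "0 < w * a" "w * a < w' * a" using assms by auto
  then have "0 < exp (w * a) - 1" "exp (w * a) - 1 < exp (w' * a) - 1" by auto
  then have "a / (exp (w' * a) - 1) < a / (exp (w * a) - 1)"
    using assms by (intro divide_strict_left_mono) auto
  then show ?thesis using assms by (simp add: size_term_eq del: One_nat_def)
qed

text \<open>
  The expectation of \<open>\<Sum>k. a k * X k\<close> at the parameter \<open>q = exp (- w)\<close>; \<open>q\<^sub>n\<close> is determined by the
  condition that it equals \<open>n\<close>.
\<close>

definition expected_size :: "nat \<Rightarrow> real \<Rightarrow> real" where
  "expected_size r w = (\<Sum>\<^sub>\<infinity>k\<in>Npow r. planck 1 (w * a_nat r k) / w)"

(* The facts of the interpretation planck1 mention the index as 1, which the simplifier would turn into Suc 0. *)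
context
  notes One_nat_def [simp del]
  fixes r :: nat
  assumes r: "2 \<le> r"
begin

lemma expected_size_summable:
  assumes "0 < w"
  shows "(\<lambda>k. planck 1 (w * a_nat r k) / w) summable_on Npow r"
proof -
  obtain s where "0 < s" "s powr (real r * (real r + 1) / 2) = w"
    by (rule scale_of_weight[OF r assms])
  then have "(\<lambda>k. planck 1 (w * a_nat r k)) summable_on Npow r"
    using planck1.lattice_sum_summable[OF r, of s] by simp
  then show ?thesis
    using summable_on_cmult_left[of "\<lambda>k. planck 1 (w * a_nat r k)" "Npow r" "1 / w"] by simp
qed

lemma expected_size_lattice_sum:
  assumes "0 < s"
  shows "expected_size r (s powr (real r * (real r + 1) / 2)) =
    planck1.lattice_sum r s / s powr (real r * (real r + 1) / 2)"
  using infsum_cmult_left[OF planck1.lattice_sum_summable[OF r assms],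
      of "1 / s powr (real r * (real r + 1) / 2)"]
  by (simp add: expected_size_def planck1.lattice_sum_def)

lemma expected_size_strict_antimono:
  assumes "0 < w" "w < w'"
  shows "expected_size r w' < expected_size r w"
proof -
  let ?f = "\<lambda>w k. planck 1 (w * a_nat r k) / w"
  have sw: "?f w summable_on Npow r" and sw': "?f w' summable_on Npow r"
    using assms by (auto intro: expected_size_summable)
  show ?thesis
    unfolding expected_size_def
  proof (rule has_sum_strict_mono[OF has_sum_infsum[OF sw'] has_sum_infsum[OF sw]])
    show "(\<lambda>i\<in>{1..r}. 1) \<in> Npow r" by (rule ones_in_Npow)
    then show "planck 1 (w' * a_nat r (\<lambda>i\<in>{1..r}. 1)) / w' < planck 1 (w * a_nat r (\<lambda>i\<in>{1..r}. 1)) / w"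
      by (intro size_term_strict_antimono assms a_nat_pos)
    show "planck 1 (w' * a_nat r k) / w' \<le> planck 1 (w * a_nat r k) / w" if "k \<in> Npow r" for k
      using assms a_nat_pos[OF that] by (intro size_term_antimono) auto
  qed
qed

text \<open>
  On \<open>{w0..}\<close> every term is bounded by its value at \<open>w0\<close>, so the series converges uniformly there.
\<close>

lemma expected_size_continuous: "continuous_on {0<..} (expected_size r)"
proof -
  have "continuous_on {w0..} (expected_size r)" if w0: "0 < w0" for w0
  proof (rule uniform_limit_theorem)
    show "\<forall>\<^sub>F X in finite_subsets_at_top (Npow r). continuous_on {w0..} (\<lambda>w. \<Sum>k\<in>X. planck 1 (w * a_nat r k) / w)"
    proof (rule eventually_finite_subsets_at_top_weakI)
      fix X assume X: "finite X" "X \<subseteq> Npow r"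
      show "continuous_on {w0..} (\<lambda>w. \<Sum>k\<in>X. planck 1 (w * a_nat r k) / w)"
      proof (rule continuous_on_sum)
        fix k assume k: "k \<in> X"
        then have a: "0 < a_nat r k" using X a_nat_pos by blast
        have "continuous_on {w0..} (\<lambda>w. a_nat r k / (exp (w * a_nat r k) - 1))"
          using w0 a by (intro continuous_intros) auto
        then show "continuous_on {w0..} (\<lambda>w. planck 1 (w * a_nat r k) / w)"
          by (rule continuous_on_eq) (use w0 a in \<open>auto simp: size_term_eq\<close>)
      qed
    qed
    show "uniform_limit {w0..} (\<lambda>X w. \<Sum>k\<in>X. planck 1 (w * a_nat r k) / w) (expected_size r) (finite_subsets_at_top (Npow r))"
      unfolding expected_size_def
    proof (rule Weierstrass_m_test_general)
      show "(\<lambda>k. planck 1 (w0 * a_nat r k) / w0) summable_on Npow r"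
        by (rule expected_size_summable[OF w0])
      fix k w assume k: "k \<in> Npow r" and w: "w \<in> {w0..}"
      have "0 \<le> planck 1 (w * a_nat r k) / w"
        using a_nat_pos[OF k] w w0 by (intro divide_nonneg_nonneg planck_nonneg) auto
      then show "norm (planck 1 (w * a_nat r k) / w) \<le> planck 1 (w0 * a_nat r k) / w0"
        using size_term_antimono[OF w0 _ a_nat_pos[OF k], of w] w by simp
    qed
  qed simp
  then have "continuous (at w) (expected_size r)" if "0 < w" for w
    using that continuous_on_interior[of "{w / 2..}" "expected_size r" w] by simp
  then show ?thesis by (simp add: continuous_at_imp_continuous_on)
qed

text \<open>
  A single term already exceeds \<open>x\<close> for small \<open>w\<close>.
\<close>

lemma expected_size_large:
  assumes "0 < x"
  obtains w where "0 < w" "x < expected_size r w"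
proof -
  let ?k = "\<lambda>i\<in>{1..r}. 1"
  define a where "a = a_nat r ?k"
  have a: "0 < a" unfolding a_def by (rule a_nat_pos[OF ones_in_Npow])
  \<comment> \<open>The solution of \<open>a / (exp (w * a) - 1) = x + 1\<close>.\<close>
  define w where "w = ln (1 + a / (x + 1)) / a"
  have "1 < 1 + a / (x + 1)" using a assms by simp
  then have w: "0 < w" unfolding w_def using a by (intro divide_pos_pos ln_gt_zero)
  have "1 + a / (x + 1) > 0" using a assms by (intro add_pos_pos) auto
  then have "exp (w * a) = 1 + a / (x + 1)" using a by (simp add: w_def)
  then have "planck 1 (w * a) / w = x + 1"
    using a assms w by (simp add: size_term_eq)
  moreover have "planck 1 (w * a) / w \<le> expected_size r w"
  proof -
    have "0 \<le> planck 1 (w * a_nat r k) / w" if "k \<in> Npow r" for k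
      using w a_nat_pos[OF that] by (intro divide_nonneg_nonneg planck_nonneg) auto
    then show ?thesis
      unfolding expected_size_def a_def using ones_in_Npow
      by (intro finite_sum_le_infsum[OF expected_size_summable[OF w], of "{?k}", simplified]) auto
  qed
  ultimately have "x < expected_size r w" by linarith
  with w show ?thesis by (rule that)
qed

text \<open>
  The sum is at most the integral divided by \<open>s ^ r * w\<close>, and \<open>s \<ge> 1\<close> as soon as \<open>w \<ge> 1\<close>.
\<close>

lemma expected_size_small:
  assumes "0 < x"
  obtains w where "0 < w" "expected_size r w < x"
proof -
  let ?I = "planck1.profile_integral r"
  define w where "w = max 1 (?I / x + 1)"
  have w: "1 \<le> w" "?I < x * w"
  proof -
    have "?I < x * (?I / x + 1)" using assms by (simp add: field_simps)
    also have "\<dots> \<le> x * w" using assms by (intro mult_left_mono) (auto simp: w_def)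
    finally show "?I < x * w" .
  qed (simp add: w_def)
  obtain s where s: "0 < s" "s powr (real r * (real r + 1) / 2) = w"
    using scale_of_weight[OF r, of w] w by auto
  have "1 \<le> s"
  proof (rule ccontr)
    assume "\<not> 1 \<le> s"
    then have "s powr (real r * (real r + 1) / 2) < 1 powr (real r * (real r + 1) / 2)"
      using s r by (intro powr_less_mono2) auto
    then show False using s w by simp
  qed
  then have "1 \<le> s ^ r" by simp
  then have "1 * planck1.lattice_sum r s \<le> s ^ r * planck1.lattice_sum r s"
    using planck1.lattice_sum_nonneg[OF r s(1)] by (intro mult_right_mono)
  also have "\<dots> \<le> ?I" by (rule planck1.lattice_sum_le[OF r s(1)])
  finally have "planck1.lattice_sum r s < x * w" using w by simp
  then have "expected_size r w < x"
    using expected_size_lattice_sum[OF s(1)] w unfolding s(2) by (simp add: divide_less_eq)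
  moreover have "0 < w" using w by linarith
  ultimately show ?thesis by (intro that)
qed

lemma expected_size_surj:
  assumes "0 < x"
  obtains w where "0 < w" "expected_size r w = x"
proof -
  obtain w1 where w1: "0 < w1" "x < expected_size r w1" by (rule expected_size_large[OF assms])
  obtain w2 where w2: "0 < w2" "expected_size r w2 < x" by (rule expected_size_small[OF assms])
  have "w1 \<le> w2"
    using expected_size_strict_antimono[of w2 w1] w1 w2 by (cases "w1 \<le> w2") auto
  moreover have "continuous_on {w1..w2} (expected_size r)"
    using w1 by (intro continuous_on_subset[OF expected_size_continuous]) auto
  ultimately obtain w where "w1 \<le> w" "w \<le> w2" and wx: "expected_size r w = x"
    using IVT2'[of "expected_size r" w2 x w1] w1 w2 by (auto simp: less_imp_le)
  then have "0 < w" using w1 by linarith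
  then show ?thesis using wx by (rule that)
qed

lemma size_has_sum_iff:
  assumes "0 < w"
  shows "((\<lambda>k. a_nat r k * exp (- w) powr a_nat r k / (1 - exp (- w) powr a_nat r k)) has_sum x) (Npow r)
    \<longleftrightarrow> expected_size r w = x"
proof -
  have "(\<lambda>k. a_nat r k * exp (- w) powr a_nat r k / (1 - exp (- w) powr a_nat r k)) =
      (\<lambda>k. planck 1 (w * a_nat r k) / w)"
    using planck_rescale[OF assms, of _ 1] by simp
  then show ?thesis
    using expected_size_summable[OF assms] by (simp add: has_sum_iff expected_size_def)
qed

text \<open>
  The last equation is the defining equation of \<open>q\<^sub>n\<close> in terms of \<open>s\<^sub>n\<close>; both definite descriptions
  are resolved here and do not occur later.
\<close>

lemma saddle_point:
  assumes "1 \<le> n"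
  shows "0 < s_seq r n"
    and "q_seq r n = exp (- (s_seq r n powr (real r * (real r + 1) / 2)))"
    and "s_seq r n powr (real r * (real r + 1) / 2) * real n = planck1.lattice_sum r (s_seq r n)"
proof -
  let ?d = "real r * (real r + 1) / 2"
  obtain w where w: "0 < w" "expected_size r w = real n"
    using expected_size_surj[of "real n"] assms by auto
  have q: "q_seq r n = exp (- w)"
    unfolding q_seq_def
  proof (rule the_equality)
    show "0 < exp (- w) \<and> exp (- w) < 1 \<and>
     ((\<lambda>k. a_nat r k * exp (- w) powr a_nat r k / (1 - exp (- w) powr a_nat r k)) has_sum real n) (Npow r)"
      using w size_has_sum_iff[OF w(1)] by auto
    fix q :: real
    assume q: "0 < q \<and> q < 1 \<and> ((\<lambda>k. a_nat r k * q powr a_nat r k / (1 - q powr a_nat r k)) has_sum real n) (Npow r)"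
    define v where "v = - ln q"
    have v: "0 < v" "q = exp (- v)" using q by (auto simp: v_def)
    then have "expected_size r v = real n" using q size_has_sum_iff[OF v(1)] by simp
    then have "v = w"
      using expected_size_strict_antimono[of v w] expected_size_strict_antimono[of w v] v w
      by (cases v w rule: linorder_cases) auto
    then show "q = exp (- w)" using v by simp
  qed
  obtain s where s: "0 < s" "s powr ?d = w" by (rule scale_of_weight[OF r w(1)])
  have "s_seq r n = s"
    unfolding s_seq_def q
  proof (rule the_equality)
    show "0 < s \<and> exp (- w) = exp (- (s powr ?d))" using s by simp
    fix t assume t: "0 < t \<and> exp (- w) = exp (- (t powr ?d))"
    then have "t powr ?d = s powr ?d" using s by simp
    then show "t = s"
      using powr_less_mono2[of ?d s t] powr_less_mono2[of ?d t s] s t r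
      by (cases s t rule: linorder_cases) auto
  qed
  then show "0 < s_seq r n" "q_seq r n = exp (- (s_seq r n powr ?d))"
    "s_seq r n powr ?d * real n = planck1.lattice_sum r (s_seq r n)"
    using s q w expected_size_lattice_sum[OF s(1)] by auto
qed

end

section \<open>Asymptotics of the scale, the variance and the third sum\<close>

lemma inverse_power_near_1:
  fixes z :: real
  assumes "1 / 2 \<le> z" "z \<le> 1"
  shows "1 \<le> inverse z ^ N" "inverse z ^ N \<le> 2 ^ N" "inverse z ^ N - 1 \<le> 2 ^ N * (real N * (1 - z))"
proof -
  have iz: "1 \<le> inverse z" "inverse z \<le> 2" using assms by (auto simp: field_simps)
  then show 1: "1 \<le> inverse z ^ N" "inverse z ^ N \<le> 2 ^ N"
    using one_le_power[OF iz(1), of N] power_mono[OF iz(2), of N] assms by simp_all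
  have "1 + real N * (z - 1) \<le> z ^ N"
    using Bernoulli_inequality[of "z - 1" N] assms by simp
  then have *: "1 - z ^ N \<le> real N * (1 - z)" by (simp add: algebra_simps)
  have zN: "z ^ N \<le> 1" using assms by (intro power_le_one) auto
  have "inverse z ^ N - 1 = inverse z ^ N * (1 - z ^ N)"
    using assms by (simp add: algebra_simps power_mult_distrib[symmetric])
  also have "\<dots> \<le> 2 ^ N * (real N * (1 - z))"
    using 1 * zN by (intro mult_mono) auto
  finally show "inverse z ^ N - 1 \<le> 2 ^ N * (real N * (1 - z))" .
qed

lemma C_const_eq:
  assumes "2 \<le> r"
  shows "C_const r = planck1.profile_integral r powr (2 / (real r * (real r + 3)))"
    and "set_integrable (lebesgue_pow r) (orthant r) (C_integrand r)"
proof -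
  have "C_integrand r = (\<lambda>t. planck 1 (a_fun r t))"
    by (simp add: C_integrand_def planck_def fun_eq_iff)
  moreover have "planck 1 0 = 0" by (simp add: planck_def)
  ultimately show "C_const r = planck1.profile_integral r powr (2 / (real r * (real r + 3)))"
    and "set_integrable (lebesgue_pow r) (orthant r) (C_integrand r)"
    using planck1.profile_orthant[OF assms] unfolding C_const_def by simp_all
qed

lemma C_var_eq:
  assumes "2 \<le> r"
  shows "C_var r = planck2.profile_integral r"
    and "set_integrable (lebesgue_pow r) (orthant r) (C_var_integrand r)"
proof -
  have "C_var_integrand r = (\<lambda>t. planck 2 (a_fun r t))"
    by (simp add: C_var_integrand_def planck_def fun_eq_iff)
  moreover have "planck 2 0 = 0" by (simp add: planck_def)
  ultimately show "C_var r = planck2.profile_integral r"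
    and "set_integrable (lebesgue_pow r) (orthant r) (C_var_integrand r)"
    using planck2.profile_orthant[OF assms] unfolding C_var_def by simp_all
qed

text \<open>
  The leading term of \<open>s\<^sub>n\<close>, that is, the solution of \<open>s powr (r (r + 3) / 2) * n = integral\<close>.
\<close>

definition s_main :: "nat \<Rightarrow> nat \<Rightarrow> real" where
  "s_main r n = C_const r * real n powr (- (2 / (real r * (real r + 3))))"

(* The facts of the interpretation planck1 mention the index as 1, which the simplifier would turn into Suc 0. *)
context
  notes One_nat_def [simp del]
  fixes r :: nat
  assumes r: "2 \<le> r"
begin

lemma C_const_pos: "0 < C_const r"
  using planck1.profile_integral_pos[OF r] C_const_eq[OF r] by simp

lemma s_main_pos: "1 \<le> n \<Longrightarrow> 0 < s_main r n"
  using C_const_pos by (simp add: s_main_def)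

lemma s_main_power:
  assumes "1 \<le> n"
  shows "s_main r n powr (real r * (real r + 3) / 2) = planck1.profile_integral r / real n"
proof -
  have 1: "2 / (real r * (real r + 3)) * (real r * (real r + 3) / 2) = 1"
  proof -
    have "real r * (real r + 3) \<noteq> 0" using r by simp
    then show ?thesis by simp
  qed
  then have 2: "- (2 / (real r * (real r + 3))) * (real r * (real r + 3) / 2) = - 1" by linarith
  show ?thesis
    unfolding s_main_def C_const_eq(1)[OF r] using planck1.profile_integral_pos[OF r] assms
    by (simp only: powr_mult powr_powr 1 2) (simp add: powr_minus_divide)
qed

text \<open>
  The quotient of a lattice sum and its integral is at most \<open>1\<close>, so \<open>s\<^sub>n\<close> never exceeds its leading
  term, and an error \<open>O(s powr (1 / r))\<close> on the right-hand side passes to \<open>s\<^sub>n\<close> itself.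
\<close>

lemma s_seq_ratio_power:
  assumes "1 \<le> n"
  shows "(s_seq r n / s_main r n) powr (real r * (real r + 3) / 2) =
    s_seq r n ^ r * planck1.lattice_sum r (s_seq r n) / planck1.profile_integral r"
proof -
  let ?s = "s_seq r n"
  have s: "0 < ?s" by (rule saddle_point(1)[OF r assms])
  have "real r * (real r + 3) / 2 = real r + real r * (real r + 1) / 2"
    by (simp add: field_simps)
  then have "?s powr (real r * (real r + 3) / 2) * real n = ?s ^ r * planck1.lattice_sum r ?s"
    using saddle_point(3)[OF r assms] s by (simp only: powr_add powr_realpow mult.assoc)
  then show ?thesis
    using s s_main_pos[OF assms] assms by (simp add: powr_divide s_main_power)
qed

lemma s_seq_le_main:
  assumes "1 \<le> n"
  shows "s_seq r n \<le> s_main r n"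
proof (rule ccontr)
  assume "\<not> s_seq r n \<le> s_main r n"
  then have "1 < s_seq r n / s_main r n" using s_main_pos[OF assms] by simp
  then have "1 powr (real r * (real r + 3) / 2) < (s_seq r n / s_main r n) powr (real r * (real r + 3) / 2)"
    using r by (intro powr_less_mono2) auto
  also have "\<dots> \<le> 1"
    unfolding s_seq_ratio_power[OF assms]
    using planck1.lattice_sum_le[OF r saddle_point(1)[OF r assms]] planck1.profile_integral_pos[OF r]
    by simp
  finally show False by simp
qed

lemma s_main_root:
  assumes "1 \<le> n"
  shows "s_main r n powr (1 / real r) = C_const r powr (1 / real r) * real n powr (- (2 / ((real r)\<^sup>2 * (real r + 3))))"
proof -
  have "- (2 / (real r * (real r + 3))) * (1 / real r) = - (2 / ((real r)\<^sup>2 * (real r + 3)))"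
    by (simp add: power2_eq_square)
  then show ?thesis
    unfolding s_main_def using C_const_pos by (simp only: powr_mult powr_powr)
qed

lemma s_seq_root_le:
  assumes "1 \<le> n"
  shows "s_seq r n powr (1 / real r) \<le> C_const r powr (1 / real r) * real n powr (- (2 / ((real r)\<^sup>2 * (real r + 3))))"
  unfolding s_main_root[OF assms, symmetric]
  using s_seq_le_main[OF assms] saddle_point(1)[OF r assms] by (intro powr_mono2) auto

lemma s_main_tendsto_0: "(s_main r \<longlongrightarrow> 0) sequentially"
proof -
  have "((\<lambda>n. C_const r * real n powr (- (2 / (real r * (real r + 3))))) \<longlongrightarrow> C_const r * 0) sequentially"
    using r by (intro tendsto_mult tendsto_const tendsto_neg_powr filterlim_real_sequentially) auto
  then show ?thesis by (simp add: s_main_def[abs_def])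
qed

lemma eventually_s_seq_le_1: "\<forall>\<^sub>F n in sequentially. 1 \<le> n \<and> s_seq r n \<le> 1"
proof -
  have "\<forall>\<^sub>F n in sequentially. s_main r n < 1"
    by (rule order_tendstoD[OF s_main_tendsto_0]) simp
  then show ?thesis
    using eventually_ge_at_top[of 1]
    by eventually_elim (use s_seq_le_main in fastforce)
qed

text \<open>
  The ratio \<open>z = s\<^sub>n / s_main\<close> lies in \<open>(0, 1]\<close> and the exponent \<open>r (r + 3) / 2\<close> is at least \<open>1\<close>, so
  \<open>z\<close> is no further from \<open>1\<close> than its power. This avoids expanding a root.
\<close>

lemma s_seq_ratio_bounds:
  obtains C where "0 \<le> C" "\<And>n. \<lbrakk>1 \<le> n; s_seq r n \<le> 1\<rbrakk> \<Longrightarrow>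
    1 - C * real n powr (- (2 / ((real r)\<^sup>2 * (real r + 3)))) \<le> s_seq r n / s_main r n \<and> s_seq r n / s_main r n \<le> 1"
proof -
  obtain C where C0: "0 \<le> C" and C: "\<And>s. \<lbrakk>0 < s; s \<le> 1\<rbrakk> \<Longrightarrow>
    1 - C * s powr (1 / real r) \<le> s ^ r * planck1.lattice_sum r s / planck1.profile_integral r"
    by (rule planck1.lattice_sum_asymptotics[OF r]) blast
  show ?thesis
  proof (rule that[of "C * C_const r powr (1 / real r)"])
    show "0 \<le> C * C_const r powr (1 / real r)" using C0 by simp
    fix n :: nat assume n: "1 \<le> n" and s1: "s_seq r n \<le> 1"
    let ?z = "s_seq r n / s_main r n"
    have s: "0 < s_seq r n" by (rule saddle_point(1)[OF r n])
    have z: "0 < ?z" "?z \<le> 1" using s s_main_pos[OF n] s_seq_le_main[OF n] by auto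
    have "1 - C * C_const r powr (1 / real r) * real n powr (- (2 / ((real r)\<^sup>2 * (real r + 3))))
        \<le> 1 - C * s_seq r n powr (1 / real r)"
      using mult_left_mono[OF s_seq_root_le[OF n] C0] by (simp add: mult.assoc)
    also have "\<dots> \<le> ?z powr (real r * (real r + 3) / 2)"
      using C[OF s s1] by (simp only: s_seq_ratio_power[OF n])
    also have "\<dots> \<le> ?z powr 1"
    proof (rule powr_mono')
      have "2 * 3 \<le> real r * (real r + 3)" using r by (intro mult_mono) auto
      then show "1 \<le> real r * (real r + 3) / 2" by simp
    qed (use z in auto)
    finally show "1 - C * C_const r powr (1 / real r) * real n powr (- (2 / ((real r)\<^sup>2 * (real r + 3)))) \<le> ?z \<and> ?z \<le> 1"
      using z by simp
  qed
qed

lemma s_seq_asymptotics: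
  "(\<lambda>n. s_seq r n / s_main r n - 1) \<in> O(\<lambda>n. real n powr (- (2 / ((real r)\<^sup>2 * (real r + 3)))))"
proof -
  obtain C where C0: "0 \<le> C" and C: "\<And>n. \<lbrakk>1 \<le> n; s_seq r n \<le> 1\<rbrakk> \<Longrightarrow>
    1 - C * real n powr (- (2 / ((real r)\<^sup>2 * (real r + 3)))) \<le> s_seq r n / s_main r n \<and> s_seq r n / s_main r n \<le> 1"
    by (rule s_seq_ratio_bounds) blast
  show ?thesis
  proof (rule bigoI[of _ C])
    show "\<forall>\<^sub>F n in sequentially. norm (s_seq r n / s_main r n - 1)
        \<le> C * norm (real n powr (- (2 / ((real r)\<^sup>2 * (real r + 3)))))"
      using eventually_s_seq_le_1 by eventually_elim (use C in fastforce)
  qed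
qed

lemma sigma_sq_term_eq:
  assumes "1 \<le> n"
  shows "sigma_sq_term r n k = planck 2 (s_seq r n powr (real r * (real r + 1) / 2) * a_nat r k)
     * (1 / (s_seq r n powr (real r * (real r + 1) / 2))\<^sup>2)"
  unfolding sigma_sq_term_def saddle_point(2)[OF r assms]
  using planck_rescale[of "s_seq r n powr (real r * (real r + 1) / 2)" "a_nat r k" 2] saddle_point(1)[OF r assms]
  by simp

lemma sigma_sq_summable:
  assumes "1 \<le> n"
  shows "sigma_sq_term r n summable_on Npow r"
  unfolding ext[OF sigma_sq_term_eq[OF assms]]
  by (intro summable_on_cmult_left planck2.lattice_sum_summable r saddle_point(1) assms)

lemma sigma_sq_ratio:
  assumes "1 \<le> n"
  shows "sigma_sq r n / (C_var r * s_seq r n powr (- (real r * (real r + 2)))) =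
    s_seq r n ^ r * planck2.lattice_sum r (s_seq r n) / planck2.profile_integral r"
proof -
  let ?s = "s_seq r n"
  have s: "0 < ?s" by (rule saddle_point(1)[OF r assms])
  have "sigma_sq r n = planck2.lattice_sum r ?s * (1 / (?s powr (real r * (real r + 1) / 2))\<^sup>2)"
    unfolding sigma_sq_def sigma_sq_term_eq[OF assms] planck2.lattice_sum_def
    by (rule infsum_cmult_left) (rule planck2.lattice_sum_summable[OF r s])
  moreover have "?s powr (- (real r * (real r + 2))) = 1 / (?s ^ r * (?s powr (real r * (real r + 1) / 2))\<^sup>2)"
  proof -
    have "real r * (real r + 2) = real r + (real r * (real r + 1) / 2 + real r * (real r + 1) / 2)"
      by (simp add: field_simps)
    then show ?thesis using s
      by (simp only: powr_minus_divide powr_add power2_eq_square powr_realpow)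
  qed
  ultimately show ?thesis using s by (simp add: C_var_eq[OF r])
qed

lemma sigma_sq_ratio_bounds:
  obtains C where "0 \<le> C" "\<And>n. \<lbrakk>1 \<le> n; s_seq r n \<le> 1\<rbrakk> \<Longrightarrow>
    \<bar>sigma_sq r n / (C_var r * s_seq r n powr (- (real r * (real r + 2)))) - 1\<bar> \<le> C * s_seq r n powr (1 / real r)"
proof -
  obtain C where C0: "0 \<le> C" and C: "\<And>s. \<lbrakk>0 < s; s \<le> 1\<rbrakk> \<Longrightarrow>
    1 - C * s powr (1 / real r) \<le> s ^ r * planck2.lattice_sum r s / planck2.profile_integral r"
    by (rule planck2.lattice_sum_asymptotics[OF r]) blast
  show ?thesis
  proof (rule that[OF C0])
    fix n :: nat assume n: "1 \<le> n" and s1: "s_seq r n \<le> 1"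
    let ?x = "s_seq r n ^ r * planck2.lattice_sum r (s_seq r n) / planck2.profile_integral r"
    have "?x \<le> 1"
      using planck2.lattice_sum_le[OF r saddle_point(1)[OF r n]] planck2.profile_integral_pos[OF r] by simp
    then show "\<bar>sigma_sq r n / (C_var r * s_seq r n powr (- (real r * (real r + 2)))) - 1\<bar> \<le> C * s_seq r n powr (1 / real r)"
      unfolding sigma_sq_ratio[OF n] using C[OF saddle_point(1)[OF r n] s1] by linarith
  qed
qed

lemma sigma_sq_asymptotics:
  "(\<lambda>n. sigma_sq r n / (C_var r * s_seq r n powr (- (real r * (real r + 2)))) - 1) \<in> O(\<lambda>n. s_seq r n powr (1 / real r))"
proof -
  obtain C where C0: "0 \<le> C" and C: "\<And>n. \<lbrakk>1 \<le> n; s_seq r n \<le> 1\<rbrakk> \<Longrightarrow>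
    \<bar>sigma_sq r n / (C_var r * s_seq r n powr (- (real r * (real r + 2)))) - 1\<bar> \<le> C * s_seq r n powr (1 / real r)"
    by (rule sigma_sq_ratio_bounds) blast
  show ?thesis
  proof (rule bigoI[of _ C])
    show "\<forall>\<^sub>F n in sequentially. norm (sigma_sq r n / (C_var r * s_seq r n powr (- (real r * (real r + 2)))) - 1)
        \<le> C * norm (s_seq r n powr (1 / real r))"
      using eventually_s_seq_le_1 by eventually_elim (use C in simp)
  qed
qed

lemma variance_main_term:
  assumes "1 \<le> n"
  shows "D_var r * real n powr (2 * (real r + 2) / (real r + 3)) = C_var r * s_main r n powr (- (real r * (real r + 2)))"
proof -
  have e: "- (2 / (real r * (real r + 3))) * - (real r * (real r + 2)) = 2 * (real r + 2) / (real r + 3)"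
    using r by (simp add: divide_simps)
  have "real (r * (r + 2)) = real r * (real r + 2)" by (simp add: algebra_simps)
  then have "C_const r powr (- (real r * (real r + 2))) = 1 / C_const r ^ (r * (r + 2))"
    using powr_realpow[OF C_const_pos, of "r * (r + 2)"] by (simp only: powr_minus_divide)
  then show ?thesis
    unfolding s_main_def D_var_def using C_const_pos by (simp only: powr_mult powr_powr e) simp
qed

text \<open>
  With \<open>z = s\<^sub>n / s_main\<close> and \<open>N = r (r + 2)\<close>, passing from \<open>s\<^sub>n\<close> to its leading term multiplies the
  relative error \<open>1 + e\<close> by \<open>inverse z ^ N\<close>. As \<open>z\<close> is eventually at least \<open>1 / 2\<close>, this factor is
  \<open>1 + O(1 - z)\<close>.
\<close>

lemma sigma_sq_asymptotics_n:
  "(\<lambda>n. sigma_sq r n / (D_var r * real n powr (2 * (real r + 2) / (real r + 3))) - 1)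
    \<in> O(\<lambda>n. real n powr (- (2 / ((real r)\<^sup>2 * (real r + 3)))))"
proof -
  define \<beta> where "\<beta> = 2 / ((real r)\<^sup>2 * (real r + 3))"
  define N where "N = r * (r + 2)"
  obtain C1 where C1: "0 \<le> C1" and ratio: "\<And>n. \<lbrakk>1 \<le> n; s_seq r n \<le> 1\<rbrakk> \<Longrightarrow>
    1 - C1 * real n powr (- \<beta>) \<le> s_seq r n / s_main r n \<and> s_seq r n / s_main r n \<le> 1"
    unfolding \<beta>_def by (rule s_seq_ratio_bounds) blast
  obtain C2 where C2: "0 \<le> C2" and var: "\<And>n. \<lbrakk>1 \<le> n; s_seq r n \<le> 1\<rbrakk> \<Longrightarrow>
    \<bar>sigma_sq r n / (C_var r * s_seq r n powr (- (real r * (real r + 2)))) - 1\<bar> \<le> C2 * s_seq r n powr (1 / real r)"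
    by (rule sigma_sq_ratio_bounds) blast
  let ?C = "C2 * C_const r powr (1 / real r) * 2 ^ N + 2 ^ N * (real N * C1)"
  have "((\<lambda>n. C1 * real n powr (- \<beta>)) \<longlongrightarrow> C1 * 0) sequentially"
    using r by (intro tendsto_mult tendsto_const tendsto_neg_powr filterlim_real_sequentially) (auto simp: \<beta>_def)
  then have "\<forall>\<^sub>F n in sequentially. C1 * real n powr (- \<beta>) < 1 / 2"
    by (rule order_tendstoD) simp
  with eventually_s_seq_le_1
  have "\<forall>\<^sub>F n in sequentially. norm (sigma_sq r n / (D_var r * real n powr (2 * (real r + 2) / (real r + 3))) - 1)
      \<le> ?C * norm (real n powr (- \<beta>))"
  proof eventually_elim
    case (elim n)
    then have n: "1 \<le> n" and s1: "s_seq r n \<le> 1" and small: "C1 * real n powr (- \<beta>) < 1 / 2" by auto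
    define z where "z = s_seq r n / s_main r n"
    define e where "e = sigma_sq r n / (C_var r * s_seq r n powr (- (real r * (real r + 2)))) - 1"
    define b where "b = real n powr (- \<beta>)"
    have s: "0 < s_seq r n" by (rule saddle_point(1)[OF r n])
    have z: "1 - z \<le> C1 * b" "1 / 2 \<le> z" "z \<le> 1"
      using ratio[OF n s1, THEN conjunct1] ratio[OF n s1, THEN conjunct2] small
      unfolding z_def b_def by linarith+
    have e: "\<bar>e\<bar> \<le> C2 * C_const r powr (1 / real r) * b"
      using var[OF n s1] mult_left_mono[OF s_seq_root_le[OF n] C2]
      by (simp add: e_def b_def \<beta>_def mult.assoc)
    have "s_seq r n powr (- (real r * (real r + 2))) = inverse z ^ N * s_main r n powr (- (real r * (real r + 2)))"
    proof -
      have "real N = real r * (real r + 2)" by (simp add: N_def algebra_simps)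
      then have "z powr (- (real r * (real r + 2))) = inverse z ^ N"
        using z powr_realpow[of z N] by (simp only: powr_minus power_inverse)
      moreover have "s_seq r n = z * s_main r n" using s_main_pos[OF n] by (simp add: z_def)
      ultimately show ?thesis using z s_main_pos[OF n] by (simp add: powr_mult)
    qed
    moreover have "C_var r \<noteq> 0"
      using planck2.profile_integral_pos[OF r] C_var_eq[OF r] by simp
    ultimately have "sigma_sq r n / (D_var r * real n powr (2 * (real r + 2) / (real r + 3))) = (1 + e) * inverse z ^ N"
      unfolding variance_main_term[OF n] e_def using z s_main_pos[OF n] by simp
    then have "\<bar>sigma_sq r n / (D_var r * real n powr (2 * (real r + 2) / (real r + 3))) - 1\<bar>
        = \<bar>e * inverse z ^ N + (inverse z ^ N - 1)\<bar>" by (simp add: algebra_simps)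
    also have "\<dots> \<le> \<bar>e * inverse z ^ N\<bar> + \<bar>inverse z ^ N - 1\<bar>" by (rule abs_triangle_ineq)
    also have "\<dots> = \<bar>e\<bar> * inverse z ^ N + (inverse z ^ N - 1)"
      using inverse_power_near_1(1)[OF z(2,3), of N] by (simp add: abs_mult)
    also have "\<dots> \<le> C2 * C_const r powr (1 / real r) * b * 2 ^ N + 2 ^ N * (real N * (1 - z))"
      using e inverse_power_near_1[OF z(2,3), of N] by (intro add_mono mult_mono) auto
    also have "\<dots> \<le> C2 * C_const r powr (1 / real r) * b * 2 ^ N + 2 ^ N * (real N * (C1 * b))"
      using z by (intro add_left_mono mult_left_mono) auto
    also have "\<dots> = ?C * b" by (simp add: algebra_simps)
    finally show ?case by (simp add: b_def)
  qed
  then show ?thesis unfolding \<beta>_def[symmetric] by (rule bigoI)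
qed

lemma third_term_eq:
  assumes "1 \<le> n"
  shows "third_term r n k = planck 3 (s_seq r n powr (real r * (real r + 1) / 2) * a_nat r k)
     * (1 / (s_seq r n powr (real r * (real r + 1) / 2)) ^ 3)"
  unfolding third_term_def saddle_point(2)[OF r assms]
  using planck_rescale[of "s_seq r n powr (real r * (real r + 1) / 2)" "a_nat r k" 3] saddle_point(1)[OF r assms]
  by simp

lemma third_term_bounds:
  assumes "1 \<le> n" "k \<in> Npow r"
  shows "0 \<le> third_term r n k"
    and "third_term r n k \<le> 1 / (1 + s_seq r n powr (real r * (real r + 1) / 2) * a_nat r k)
      * (24 / (s_seq r n powr (real r * (real r + 1) / 2)) ^ 3)"
proof -
  let ?w = "s_seq r n powr (real r * (real r + 1) / 2)"
  have w: "0 < ?w" using saddle_point(1)[OF r assms(1)] by simp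
  then have x: "0 < ?w * a_nat r k" using a_nat_pos[OF assms(2)] by simp
  then show "0 \<le> third_term r n k"
    unfolding third_term_eq[OF assms(1)] using w
    by (intro mult_nonneg_nonneg[OF planck_nonneg[OF less_imp_le[OF x]]]) auto
  have "planck 3 (?w * a_nat r k) * (1 / ?w ^ 3) \<le> 24 / (1 + ?w * a_nat r k) * (1 / ?w ^ 3)"
    using planck_le[OF x, of 3] w by (intro mult_right_mono) auto
  then show "third_term r n k \<le> 1 / (1 + ?w * a_nat r k) * (24 / ?w ^ 3)"
    unfolding third_term_eq[OF assms(1)] by simp
qed

lemma third_term_majorant_summable:
  "1 \<le> n \<Longrightarrow> (\<lambda>k. 1 / (1 + s_seq r n powr (real r * (real r + 1) / 2) * a_nat r k)
      * (24 / (s_seq r n powr (real r * (real r + 1) / 2)) ^ 3)) summable_on Npow r"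
  by (intro summable_on_cmult_left decay.lattice_sum_summable r saddle_point(1))

lemma third_term_summable:
  assumes "1 \<le> n"
  shows "third_term r n summable_on Npow r"
  using third_term_bounds(2)[OF assms] third_term_bounds(1)[OF assms]
  by (rule summable_on_comparison_test[OF third_term_majorant_summable[OF assms]])

text \<open>
  \<open>planck 3\<close> is replaced by the decreasing majorant \<open>24 / (1 + x)\<close>, whose lattice sum is at most
  \<open>s powr - r\<close> times a convergent integral; the exponents add up to \<open>r + 3 r (r + 1) / 2\<close>.
\<close>

lemma third_term_sum_le:
  assumes "1 \<le> n"
  shows "(\<Sum>\<^sub>\<infinity>k\<in>Npow r. third_term r n k)
    \<le> 24 * decay.profile_integral r * s_seq r n powr (- (real r * (3 * real r + 5) / 2))"
proof -
  let ?s = "s_seq r n"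
  let ?w = "?s powr (real r * (real r + 1) / 2)"
  have s: "0 < ?s" by (rule saddle_point(1)[OF r assms])
  have "(\<Sum>\<^sub>\<infinity>k\<in>Npow r. third_term r n k) \<le> (\<Sum>\<^sub>\<infinity>k\<in>Npow r. 1 / (1 + ?w * a_nat r k) * (24 / ?w ^ 3))"
    using assms by (intro infsum_mono third_term_summable third_term_majorant_summable third_term_bounds)
  also have "\<dots> = decay.lattice_sum r ?s * (24 / ?w ^ 3)"
    unfolding decay.lattice_sum_def
    by (rule infsum_cmult_left) (rule decay.lattice_sum_summable[OF r s])
  also have "\<dots> = (?s ^ r * decay.lattice_sum r ?s) * (24 * (1 / (?s ^ r * ?w ^ 3)))"
    using s by simp
  also have "\<dots> \<le> decay.profile_integral r * (24 * (1 / (?s ^ r * ?w ^ 3)))"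
    using decay.lattice_sum_le[OF r s] s by (intro mult_right_mono) auto
  also have "1 / (?s ^ r * ?w ^ 3) = ?s powr (- (real r * (3 * real r + 5) / 2))"
  proof -
    have "real r * (3 * real r + 5) / 2 = real r + (real r * (real r + 1) / 2 * (real r * (real r + 1) / 2 / (real r * (real r + 1) / 2)) * 3)"
      using r by (simp add: field_simps)
    also have "\<dots> = real r + (real r * (real r + 1) / 2 + real r * (real r + 1) / 2 + real r * (real r + 1) / 2)"
      using r by simp
    finally show ?thesis using s
      by (simp only: powr_minus_divide powr_add power3_eq_cube powr_realpow)
  qed
  finally show ?thesis by (simp add: mult_ac)
qed

lemma third_term_asymptotics:
  "(\<lambda>n. \<Sum>\<^sub>\<infinity>k\<in>Npow r. third_term r n k) \<in> O(\<lambda>n. s_seq r n powr (- (real r * (3 * real r + 5) / 2)))"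
proof (rule bigoI)
  show "\<forall>\<^sub>F n in sequentially. norm (\<Sum>\<^sub>\<infinity>k\<in>Npow r. third_term r n k) \<le>
     24 * decay.profile_integral r * norm (s_seq r n powr (- (real r * (3 * real r + 5) / 2)))"
    using eventually_ge_at_top[of "1::nat"]
  proof eventually_elim
    case (elim n)
    have "0 \<le> (\<Sum>\<^sub>\<infinity>k\<in>Npow r. third_term r n k)"
      using elim by (intro infsum_nonneg third_term_bounds)
    then show ?case using third_term_sum_le[OF elim] by simp
  qed
qed

end

theorem proposition4p3:
  fixes r :: nat
  assumes "r \<ge> 2"
  shows
    "set_integrable (lebesgue_pow r) (orthant r) (C_integrand r) \<and>
     set_integrable (lebesgue_pow r) (orthant r) (C_var_integrand r) \<and>
     (\<exists>E \<in> O(\<lambda>n. real n powr (- (2 / ((real r)\<^sup>2 * (real r + 3))))).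
        \<forall>\<^sub>F n in sequentially.
          s_seq r n = C_const r * real n powr (- (2 / (real r * (real r + 3)))) * (1 + E n)) \<and>
     (\<forall>n\<ge>1. sigma_sq_term r n summable_on Npow r) \<and>
     (\<exists>E \<in> O(\<lambda>n. s_seq r n powr (1 / real r)).
        \<forall>\<^sub>F n in sequentially.
          sigma_sq r n = C_var r * s_seq r n powr (- (real r * (real r + 2))) * (1 + E n)) \<and>
     (\<exists>E \<in> O(\<lambda>n. real n powr (- (2 / ((real r)\<^sup>2 * (real r + 3))))).
        \<forall>\<^sub>F n in sequentially.
          sigma_sq r n = D_var r * real n powr (2 * (real r + 2) / (real r + 3)) * (1 + E n)) \<and>
     (\<forall>n\<ge>1. third_term r n summable_on Npow r) \<and>
     (\<lambda>n. \<Sum>\<^sub>\<infinity>k\<in>Npow r. third_term r n k)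
        \<in> O(\<lambda>n. s_seq r n powr (- (real r * (3 * real r + 5) / 2)))"
proof -
  have ev: "\<forall>\<^sub>F n in sequentially. 1 \<le> (n::nat)" by (rule eventually_ge_at_top)
  have C_var: "C_var r \<noteq> 0"
    using planck2.profile_integral_pos[OF assms] C_var_eq[OF assms] by simp
  have s: "\<forall>\<^sub>F n in sequentially. s_seq r n =
      C_const r * real n powr (- (2 / (real r * (real r + 3)))) * (1 + (s_seq r n / s_main r n - 1))"
    using ev
  proof eventually_elim
    case (elim n)
    then show ?case using s_main_pos[OF assms elim] by (simp add: s_main_def[symmetric])
  qed
  have var: "\<forall>\<^sub>F n in sequentially. sigma_sq r n = C_var r * s_seq r n powr (- (real r * (real r + 2))) *
      (1 + (sigma_sq r n / (C_var r * s_seq r n powr (- (real r * (real r + 2)))) - 1))"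
    using ev
  proof eventually_elim
    case (elim n)
    then show ?case using saddle_point(1)[OF assms elim] C_var by simp
  qed
  have var_n: "\<forall>\<^sub>F n in sequentially. sigma_sq r n = D_var r * real n powr (2 * (real r + 2) / (real r + 3)) *
      (1 + (sigma_sq r n / (D_var r * real n powr (2 * (real r + 2) / (real r + 3))) - 1))"
    using ev
  proof eventually_elim
    case (elim n)
    then show ?case using C_var C_const_pos[OF assms] by (simp add: D_var_def)
  qed
  have s_ex: "\<exists>E \<in> O(\<lambda>n. real n powr (- (2 / ((real r)\<^sup>2 * (real r + 3))))). \<forall>\<^sub>F n in sequentially.
      s_seq r n = C_const r * real n powr (- (2 / (real r * (real r + 3)))) * (1 + E n)"
    by (rule bexI[OF _ s_seq_asymptotics[OF assms]]) (rule s)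
  have var_ex: "\<exists>E \<in> O(\<lambda>n. s_seq r n powr (1 / real r)). \<forall>\<^sub>F n in sequentially.
      sigma_sq r n = C_var r * s_seq r n powr (- (real r * (real r + 2))) * (1 + E n)"
    by (rule bexI[OF _ sigma_sq_asymptotics[OF assms]]) (rule var)
  have var_n_ex: "\<exists>E \<in> O(\<lambda>n. real n powr (- (2 / ((real r)\<^sup>2 * (real r + 3))))). \<forall>\<^sub>F n in sequentially.
      sigma_sq r n = D_var r * real n powr (2 * (real r + 2) / (real r + 3)) * (1 + E n)"
    by (rule bexI[OF _ sigma_sq_asymptotics_n[OF assms]]) (rule var_n)
  show ?thesis
    using C_const_eq(2)[OF assms] C_var_eq(2)[OF assms] s_ex var_ex var_n_ex
      sigma_sq_summable[OF assms] third_term_summable[OF assms] third_term_asymptotics[OF assms]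
    by (intro conjI allI impI)
qed

end
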